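(* Let $G$ be a finite abelian group acting without inversion on a finite graph $Y$, and let $H\le G$ (so $H$ also acts on $Y$ without inversion). Then $$N_{G/H}(\gamma_{(Y,G)}(u))=\gamma_{(Y,H)}(u),\qquad N_{G/H}(\eta_{(Y,G)}(u))=\eta_{(Y,H)}(u),$$ and consequently $N_{G/H}(\theta_{(Y,G)}(u))=\theta_{(Y,H)}(u)$.
   Context: Graphs in Serre's sense (vertices $V_Y$, directed edges $\mathbf{E}_Y$, maps $o,t$, fixed-point-free involution $\varepsilon\mapsto\bar\varepsilon$ with $o(\bar\varepsilon)=t(\varepsilon)$); $\mathrm{val}_Y(w)=|\{\varepsilon:o(\varepsilon)=w\}|$; without inversion means $\sigma\varepsilon\ne\bar\varepsilon$. For a finite abelian group $K$ acting without inversion on $Y$: $C_0(Y)=\mathbb{C}V_Y$ and $C_1(Y)=\mathbb{C}\mathbf{E}_Y/W$, $W$ spanned by the $\varepsilon+\bar\varepsilon$, are $\mathbb{C}[K]$-modules; for a finitely generated projective module $M$ over a commutative ring $R$, $\mathrm{tr}_R(f)=\mathrm{tr}_R(f\oplus 0_N)$, $\det_R(f)=\det_R(f\oplus\mathrm{id}_N)$ for any $N$ with $M\oplus N$ free of finite rank, and $\mathrm{rank}_R M=\mathrm{tr}_R(\mathrm{id}_M)$. $\chi_{\mathbb{C}[K]}(Y)=\mathrm{rank}_{\mathbb{C}[K]}C_0(Y)-\mathrm{rank}_{\mathbb{C}[K]}C_1(Y)$. $\gamma_{(Y,K)}(u)=(1-u^2)^{-\chi_{\mathbb{C}[K]}(Y)}:=\exp(-\chi_{\mathbb{C}[K]}(Y)\log(1-u^2))\in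 1+u\mathbb{C}[K][[u]]$ (formal exponential and logarithm). $\eta_{(Y,K)}(u)=\det_{\mathbb{C}[K][u]}(\mathcal{I}-\mathcal{A}u+(\mathcal{D}-\mathcal{I})u^2)$, where $\mathcal{D}(w)=\mathrm{val}_Y(w)w$, $\mathcal{A}(w)=\sum_{o(\varepsilon)=w}t(\varepsilon)$ on $C_0(Y)$, extended coefficientwise to $C_0(Y)[u]$. $\theta_{(Y,K)}(u)=(\gamma_{(Y,K)}(u)\eta_{(Y,K)}(u))^{-1}$. $N_{G/H}:\mathbb{C}[G][[u]]\to\mathbb{C}[H][[u]]$ sends $P$ to the determinant over $\mathbb{C}[H][[u]]$ of multiplication by $P$ on the free $\mathbb{C}[H][[u]]$-module $\mathbb{C}[G][[u]]$ (of rank $[G:H]$). *)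

theory Defs
  imports
    "HOL-Library.Poly_Mapping"
    "HOL-Algebra.Group_Action"
    "HOL-Algebra.QuotRing"
    "HOL-Computational_Algebra.Polynomial_FPS"
    "Jordan_Normal_Form.Determinant"
    "Jordan_Normal_Form.VS_Connect"
    "Graph_Theory.Bidirected_Digraph"
begin

section \<open>Trace and determinant over finitely generated projective modules\<close>

text \<open>
  A commutative ring is given as a subring \<open>S\<close> of a type of class \<open>comm_ring_1\<close>, so that
  \<open>\<complex>[H]\<close> and \<open>\<complex>[G]\<close> live in the same type for \<open>H \<le> G\<close>, and matrices over \<open>S\<close> are ordinary
  matrices with entries in \<open>S\<close>.
\<close>

definition ring_on :: "'r::comm_ring_1 set \<Rightarrow> 'r ring" where
  "ring_on S = class_ring\<lparr>carrier := S\<rparr>"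

definition is_coords ::
    "'r::comm_ring_1 set \<Rightarrow> ('r, 'm) module \<Rightarrow> nat \<Rightarrow> (nat \<Rightarrow> 'm) \<Rightarrow> 'm \<Rightarrow> (nat \<Rightarrow> 'r) \<Rightarrow> bool" where
  "is_coords S M n b x c \<longleftrightarrow>
     c \<in> {..<n} \<rightarrow>\<^sub>E S \<and> x = (\<Oplus>\<^bsub>M\<^esub>i\<in>{..<n}. c i \<odot>\<^bsub>M\<^esub> b i)"

definition is_basis :: "'r::comm_ring_1 set \<Rightarrow> ('r, 'm) module \<Rightarrow> nat \<Rightarrow> (nat \<Rightarrow> 'm) \<Rightarrow> bool" where
  "is_basis S M n b \<longleftrightarrow>
     b \<in> {..<n} \<rightarrow> carrier M \<and> (\<forall>x\<in>carrier M. \<exists>!c. is_coords S M n b x c)"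

definition endo_mat ::
    "'r::comm_ring_1 set \<Rightarrow> ('r, 'm) module \<Rightarrow> nat \<Rightarrow> (nat \<Rightarrow> 'm) \<Rightarrow> ('m \<Rightarrow> 'm) \<Rightarrow> 'r mat" where
  "endo_mat S M n b f = mat n n (\<lambda>(i, j). (THE c. is_coords S M n b (f (b j)) c) i)"

text \<open>
  The complement \<open>N\<close> ranges over modules whose elements are of type \<^typ>\<open>nat \<Rightarrow> 'r\<close>: a finitely
  generated projective module always has a complement of this kind, namely the kernel of a
  surjection onto it from some \<open>S\<^sup>n\<close>. The values do not depend on \<open>N\<close> or on the basis,
  so that the descriptions below are definite.
\<close>

definition mod_trace :: "'r::comm_ring_1 set \<Rightarrow> ('r, 'm) module \<Rightarrow> ('m \<Rightarrow> 'm) \<Rightarrow> 'r" where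
  "mod_trace S M f = (THE t. \<exists>(N :: ('r, nat \<Rightarrow> 'r) module) n b.
     module (ring_on S) N \<and> is_basis S (direct_sum M N) n b \<and>
     t = (\<Sum>i<n. endo_mat S (direct_sum M N) n b (\<lambda>(x, y). (f x, \<zero>\<^bsub>N\<^esub>)) $$ (i, i)))"

definition mod_det :: "'r::comm_ring_1 set \<Rightarrow> ('r, 'm) module \<Rightarrow> ('m \<Rightarrow> 'm) \<Rightarrow> 'r" where
  "mod_det S M f = (THE d. \<exists>(N :: ('r, nat \<Rightarrow> 'r) module) n b.
     module (ring_on S) N \<and> is_basis S (direct_sum M N) n b \<and>
     d = det (endo_mat S (direct_sum M N) n b (\<lambda>(x, y). (f x, y))))"

definition mod_rank :: "'r::comm_ring_1 set \<Rightarrow> ('r, 'm) module \<Rightarrow> 'r" where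
  "mod_rank S M = mod_trace S M (\<lambda>x. x)"

definition quot_module :: "('r, 'm) module \<Rightarrow> 'm set \<Rightarrow> ('r, 'm set) module" where
  "quot_module M W = \<lparr>carrier = a_rcosets\<^bsub>M\<^esub> W, monoid.mult = undefined, one = undefined,
     zero = W, add = set_add M, smult = (\<lambda>a A. \<Union>x\<in>A. W +>\<^bsub>M\<^esub> (a \<odot>\<^bsub>M\<^esub> x))\<rparr>"

text \<open>\<open>M[u]\<close> as a module over polynomials; \<open>m\<close> stands for \<open>\<Sum>k. m k * u^k\<close>.\<close>

definition poly_module :: "('r::comm_ring_1, 'm) module \<Rightarrow> ('r poly, nat \<Rightarrow> 'm) module" where
  "poly_module M = \<lparr>carrier = {m. range m \<subseteq> carrier M \<and> finite {k. m k \<noteq> \<zero>\<^bsub>M\<^esub>}},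
     monoid.mult = undefined, one = undefined, zero = (\<lambda>k. \<zero>\<^bsub>M\<^esub>),
     add = (\<lambda>m m' k. m k \<oplus>\<^bsub>M\<^esub> m' k),
     smult = (\<lambda>p m k. \<Oplus>\<^bsub>M\<^esub>i\<in>{..k}. coeff p i \<odot>\<^bsub>M\<^esub> m (k - i))\<rparr>"

section \<open>Group algebras\<close>

text \<open>
  Groups are written additively; \<^typ>\<open>'g \<Rightarrow>\<^sub>0 complex\<close> carries the convolution product, i.e. it is
  the group algebra of the whole type \<^typ>\<open>'g\<close>, and \<open>\<complex>[K]\<close> is its subring of elements
  supported in \<open>K\<close>.
\<close>

definition add_grp :: "'g::ab_group_add set \<Rightarrow> 'g monoid" where
  "add_grp K = \<lparr>carrier = K, monoid.mult = (+), one = 0\<rparr>"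

definition grp_alg :: "'g::ab_group_add set \<Rightarrow> ('g \<Rightarrow>\<^sub>0 complex) set" where
  "grp_alg K = {a. Poly_Mapping.keys a \<subseteq> K}"

definition grp_alg_poly :: "'g::ab_group_add set \<Rightarrow> ('g \<Rightarrow>\<^sub>0 complex) poly set" where
  "grp_alg_poly K = {p. \<forall>k. coeff p k \<in> grp_alg K}"

definition grp_alg_fps :: "'g::ab_group_add set \<Rightarrow> ('g \<Rightarrow>\<^sub>0 complex) fps set" where
  "grp_alg_fps K = {P. \<forall>k. fps_nth P k \<in> grp_alg K}"

text \<open>
  Formal exponential of a series with zero constant term and formal logarithm of a series with
  constant term 1. The library series \<^term>\<open>fps_exp (1::complex)\<close> is \<open>exp(X)\<close> and
  \<^term>\<open>fps_ln (1::complex)\<close> is \<open>log(1 + X)\<close>.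
\<close>

definition lift_fps :: "complex fps \<Rightarrow> ('g::ab_group_add \<Rightarrow>\<^sub>0 complex) fps" where
  "lift_fps P = Abs_fps (\<lambda>n. Poly_Mapping.single 0 (fps_nth P n))"

definition formal_exp ::
    "('g::ab_group_add \<Rightarrow>\<^sub>0 complex) fps \<Rightarrow> ('g \<Rightarrow>\<^sub>0 complex) fps" where
  "formal_exp P = fps_compose (lift_fps (fps_exp 1)) P"

definition formal_log ::
    "('g::ab_group_add \<Rightarrow>\<^sub>0 complex) fps \<Rightarrow> ('g \<Rightarrow>\<^sub>0 complex) fps" where
  "formal_log P = fps_compose (lift_fps (fps_ln 1)) (P - 1)"

text \<open>\<open>\<complex>[G][[u]]\<close> as a module over any subring, by multiplication.\<close>

definition grp_alg_fps_module ::
    "'g::ab_group_add set \<Rightarrow> (('g \<Rightarrow>\<^sub>0 complex) fps, ('g \<Rightarrow>\<^sub>0 complex) fps) module" where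
  "grp_alg_fps_module G = \<lparr>carrier = grp_alg_fps G, monoid.mult = (*), one = 1, zero = 0, add = (+),
     smult = (*)\<rparr>"

definition norm_map ::
    "'g::ab_group_add set \<Rightarrow> 'g set \<Rightarrow> ('g \<Rightarrow>\<^sub>0 complex) fps \<Rightarrow> ('g \<Rightarrow>\<^sub>0 complex) fps" where
  "norm_map G H P = mod_det (grp_alg_fps H) (grp_alg_fps_module G) (\<lambda>Q. P * Q)"

section \<open>Graphs with a group action\<close>

text \<open>
  A graph in the sense of Serre is a bidirected digraph: directed edges are arcs, \<open>o\<close> and \<open>t\<close>
  are tail and head, and \<open>rv\<close> is the fixed-point-free involution on arcs (the library
  fixes it to be the identity off the arcs). The valency is the out-degree.
\<close>

definition acts_without_inversion ::
    "'g::ab_group_add set \<Rightarrow> ('v, 'e) pre_digraph \<Rightarrow> ('e \<Rightarrow> 'e) \<Rightarrow>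
     ('g \<Rightarrow> 'v \<Rightarrow> 'v) \<Rightarrow> ('g \<Rightarrow> 'e \<Rightarrow> 'e) \<Rightarrow> bool" where
  "acts_without_inversion K Y rv av ae \<longleftrightarrow>
     group_action (add_grp K) (verts Y) av \<and>
     group_action (add_grp K) (arcs Y) ae \<and>
     (\<forall>g\<in>K. \<forall>e\<in>arcs Y. tail Y (ae g e) = av g (tail Y e) \<and> head Y (ae g e) = av g (head Y e) \<and>
        ae g (rv e) = rv (ae g e) \<and> ae g e \<noteq> rv e)"

lemma acts_without_inversion_subgroup:
  assumes "acts_without_inversion G Y rv av ae" "subgroup H (add_grp G)"
  shows "acts_without_inversion H Y rv av ae"
proof -
  have sub: "H \<subseteq> G"
    using subgroup.subset[OF assms(2)] by (simp add: add_grp_def)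
  have H: "(add_grp G)\<lparr>carrier := H\<rparr> = add_grp H"
    by (simp add: add_grp_def)
  have act: "group_action (add_grp H) E f" 
    if "group_action (add_grp G) E f" for E and f
  proof -
    interpret A: group_hom "add_grp G" "BijGroup E" f
      using that by (simp add: group_action_def)
    have "f \<in> hom (add_grp H) (BijGroup E)"
      using A.homh sub by (auto simp: hom_def add_grp_def)
    then show ?thesis
      using A.G.subgroup_imp_group[OF assms(2)] A.H.is_group
      by (simp add: H group_action_def group_hom_def group_hom_axioms_def)
  qed
  show ?thesis
    using assms(1) sub unfolding acts_without_inversion_def by (blast intro: act)
qed

text \<open>The permutation module \<open>\<complex>X\<close> of a group action on \<open>X\<close>.\<close>

definition perm_module ::
    "('g::ab_group_add \<Rightarrow> 'x \<Rightarrow> 'x) \<Rightarrow> 'x set \<Rightarrow> ('g \<Rightarrow>\<^sub>0 complex, 'x \<Rightarrow>\<^sub>0 complex) module" where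
  "perm_module act X = \<lparr>carrier = {f. Poly_Mapping.keys f \<subseteq> X}, monoid.mult = undefined, one = undefined,
     zero = 0, add = (+),
     smult = (\<lambda>a f. \<Sum>g\<in>Poly_Mapping.keys a. \<Sum>x\<in>Poly_Mapping.keys f.
        Poly_Mapping.single (act g x) (Poly_Mapping.lookup a g * Poly_Mapping.lookup f x))\<rparr>"

definition C0 ::
    "('v, 'e) pre_digraph \<Rightarrow> ('g::ab_group_add \<Rightarrow> 'v \<Rightarrow> 'v) \<Rightarrow>
     ('g \<Rightarrow>\<^sub>0 complex, 'v \<Rightarrow>\<^sub>0 complex) module" where
  "C0 Y av = perm_module av (verts Y)"

text \<open>The complex span of the \<open>e + rv e\<close> (the arc set is finite).\<close>

definition edge_relations :: "('v, 'e) pre_digraph \<Rightarrow> ('e \<Rightarrow> 'e) \<Rightarrow> ('e \<Rightarrow>\<^sub>0 complex) set" where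
  "edge_relations Y rv =
     {\<Sum>e\<in>arcs Y. Poly_Mapping.single e (c e) + Poly_Mapping.single (rv e) (c e) | c. True}"

definition C1 ::
    "('v, 'e) pre_digraph \<Rightarrow> ('e \<Rightarrow> 'e) \<Rightarrow> ('g::ab_group_add \<Rightarrow> 'e \<Rightarrow> 'e) \<Rightarrow>
     ('g \<Rightarrow>\<^sub>0 complex, ('e \<Rightarrow>\<^sub>0 complex) set) module" where
  "C1 Y rv ae = quot_module (perm_module ae (arcs Y)) (edge_relations Y rv)"

definition equiv_euler_char ::
    "('v, 'e) pre_digraph \<Rightarrow> ('e \<Rightarrow> 'e) \<Rightarrow> ('g::ab_group_add \<Rightarrow> 'v \<Rightarrow> 'v) \<Rightarrow> ('g \<Rightarrow> 'e \<Rightarrow> 'e) \<Rightarrow>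
     'g set \<Rightarrow> 'g \<Rightarrow>\<^sub>0 complex" where
  "equiv_euler_char Y rv av ae K =
     mod_rank (grp_alg K) (C0 Y av) - mod_rank (grp_alg K) (C1 Y rv ae)"

definition gamma_fps ::
    "('v, 'e) pre_digraph \<Rightarrow> ('e \<Rightarrow> 'e) \<Rightarrow> ('g::ab_group_add \<Rightarrow> 'v \<Rightarrow> 'v) \<Rightarrow> ('g \<Rightarrow> 'e \<Rightarrow> 'e) \<Rightarrow>
     'g set \<Rightarrow> ('g \<Rightarrow>\<^sub>0 complex) fps" where
  "gamma_fps Y rv av ae K =
     formal_exp (- (fps_const (equiv_euler_char Y rv av ae K) * formal_log (1 - fps_X ^ 2)))"

definition valency_op :: "('v, 'e) pre_digraph \<Rightarrow> ('v \<Rightarrow>\<^sub>0 complex) \<Rightarrow> 'v \<Rightarrow>\<^sub>0 complex" where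
  "valency_op Y f = (\<Sum>w\<in>Poly_Mapping.keys f.
     Poly_Mapping.single w (of_nat (out_degree Y w) * Poly_Mapping.lookup f w))"

definition adjacency_op :: "('v, 'e) pre_digraph \<Rightarrow> ('v \<Rightarrow>\<^sub>0 complex) \<Rightarrow> 'v \<Rightarrow>\<^sub>0 complex" where
  "adjacency_op Y f = (\<Sum>w\<in>Poly_Mapping.keys f. \<Sum>e\<in>out_arcs Y w.
     Poly_Mapping.single (head Y e) (Poly_Mapping.lookup f w))"

definition eta_poly ::
    "('v, 'e) pre_digraph \<Rightarrow> ('g::ab_group_add \<Rightarrow> 'v \<Rightarrow> 'v) \<Rightarrow> 'g set \<Rightarrow> ('g \<Rightarrow>\<^sub>0 complex) poly" where
  "eta_poly Y av K = (let M = poly_module (C0 Y av) in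
     mod_det (grp_alg_poly K) M
       (\<lambda>m. m \<ominus>\<^bsub>M\<^esub> [:0, 1:] \<odot>\<^bsub>M\<^esub> (adjacency_op Y \<circ> m)
              \<oplus>\<^bsub>M\<^esub> [:0, 0, 1:] \<odot>\<^bsub>M\<^esub> ((\<lambda>x. valency_op Y x - x) \<circ> m)))"

definition eta_fps ::
    "('v, 'e) pre_digraph \<Rightarrow> ('g::ab_group_add \<Rightarrow> 'v \<Rightarrow> 'v) \<Rightarrow> 'g set \<Rightarrow> ('g \<Rightarrow>\<^sub>0 complex) fps" where
  "eta_fps Y av K = fps_of_poly (eta_poly Y av K)"

definition theta_fps ::
    "('v, 'e) pre_digraph \<Rightarrow> ('e \<Rightarrow> 'e) \<Rightarrow> ('g::ab_group_add \<Rightarrow> 'v \<Rightarrow> 'v) \<Rightarrow> ('g \<Rightarrow> 'e \<Rightarrow> 'e) \<Rightarrow>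
     'g set \<Rightarrow> ('g \<Rightarrow>\<^sub>0 complex) fps" where
  "theta_fps Y rv av ae K =
     inv\<^bsub>ring_on (grp_alg_fps K)\<^esub> (gamma_fps Y rv av ae K * eta_fps Y av K)"

end

theory Submission
  imports Defs
begin

text \<open>
  A module with a dual basis \<open>(gen, coord)\<close> is projective, and the determinant of an endomorphism
  \<open>f\<close> is \<open>det (1 - P + F)\<close> with \<open>P = (coord i (gen j))\<close> and \<open>F = (coord i (f (gen j)))\<close>; that this does
  not depend on the dual basis is Sylvester's identity \<open>det (1 + X Y) = det (1 + Y X)\<close>. The
  permutation module \<open>\<complex>X\<close> of a finite abelian group \<open>K\<close> has the dual basis consisting of all
  \<open>v \<in> X\<close> with coordinates \<open>f \<mapsto> (1/|K|) * (\<Sum>g\<in>K. f (g v) g)\<close>. Similarly \<open>C1\<close>, and \<open>\<complex>[G]\<close> over \<open>\<complex>[H]\<close>.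

  By Jacobi's formula, all series involved have constant term 1 and a logarithmic derivative whose
  coefficients are of the form \<open>(1/|K|) * (\<Sum>g\<in>K. c g * g)\<close>, where \<open>c\<close> does not depend on \<open>K\<close>. The
  logarithmic derivative of the norm is the trace of the logarithmic derivative, and the trace from \<open>\<complex>[G]\<close>
  to \<open>\<complex>[H]\<close> sends \<open>(1/|G|) * (\<Sum>g\<in>G. c g * g)\<close> to \<open>(1/|H|) * (\<Sum>g\<in>H. c g * g)\<close>. A series with constant
  term 1 over a \<open>\<rat>\<close>-algebra is determined by its logarithmic derivative.
\<close>

section \<open>Determinants over commutative rings\<close>

text \<open>A direct comparison of determinants over \<complex>[G] and \<complex>[H] would need the
  transitivity of determinants along \<complex>[H] \<subseteq> \<complex>[G]. Logarithmic
  derivatives replace it by traces, which are additive and can be read off coefficient by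
  coefficient. The generators are deliberately redundant: all of X for \<complex>X, and all of G for
  \<complex>[G] over \<complex>[H]. No orbit or coset representatives are chosen and no stabilisers
  appear. The price is that P is an idempotent matrix instead of 1, and the weight 1/|K| is what
  makes it idempotent. The gain is that the matrices over \<complex>[K] arise for every K by
  averaging one complex matrix on X, and that averaging respects products of equivariant matrices
  (\<open>avg_coord_mult\<close>). So the computation takes place in complex matrices in which K
  does not occur.\<close>

lemma det_four_block_upper_left_one:
  fixes X C :: "'a::comm_ring_1 mat"
  assumes "X \<in> carrier_mat n m" "C \<in> carrier_mat m m"
  shows "det (four_block_mat (1\<^sub>m n) X (0\<^sub>m m n) C) = det C"
  using assms
proof (induction n arbitrary: X)
  case 0
  have "four_block_mat (1\<^sub>m 0) X (0\<^sub>m m 0) C = C"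
    using 0 by (intro eq_matI) auto
  then show ?case by simp
next
  case (Suc n)
  let ?A = "four_block_mat (1\<^sub>m (Suc n)) X (0\<^sub>m m (Suc n)) C"
  let ?X = "mat n m (\<lambda>(i, j). X $$ (Suc i, j))"
  have A: "?A \<in> carrier_mat (Suc n + m) (Suc n + m)"
    using Suc.prems by (intro four_block_carrier_mat) auto
  have del: "mat_delete ?A 0 0 = four_block_mat (1\<^sub>m n) ?X (0\<^sub>m m n) C"
    using Suc.prems by (intro eq_matI) (auto simp: mat_delete_def)
  have "det ?A = (\<Sum>i<Suc n + m. ?A $$ (i, 0) * cofactor ?A i 0)"
    by (rule laplace_expansion_column[OF A]) simp
  also have "\<dots> = (\<Sum>i<Suc n + m. if i = 0 then cofactor ?A 0 0 else 0)"
    using Suc.prems by (intro sum.cong) auto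
  also have "\<dots> = det (mat_delete ?A 0 0)"
    by (simp add: cofactor_def)
  finally show ?case
    using Suc.IH[of ?X] Suc.prems by (simp add: del)
qed

lemma det_four_block_lower_right_one:
  fixes X C :: "'a::comm_ring_1 mat"
  assumes "X \<in> carrier_mat n m" "C \<in> carrier_mat n n"
  shows "det (four_block_mat C X (0\<^sub>m m n) (1\<^sub>m m)) = det C"
  using assms
proof (induction m arbitrary: X)
  case 0
  have "four_block_mat C X (0\<^sub>m 0 n) (1\<^sub>m 0) = C"
    using 0 by (intro eq_matI) auto
  then show ?case by simp
next
  case (Suc m)
  let ?A = "four_block_mat C X (0\<^sub>m (Suc m) n) (1\<^sub>m (Suc m))"
  let ?X = "mat n m (\<lambda>(i, j). X $$ (i, j))"
  let ?l = "n + m"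
  have A: "?A \<in> carrier_mat (n + Suc m) (n + Suc m)"
    using Suc.prems by (intro four_block_carrier_mat) auto
  have del: "mat_delete ?A ?l ?l = four_block_mat C ?X (0\<^sub>m m n) (1\<^sub>m m)"
    using Suc.prems by (intro eq_matI) (auto simp: mat_delete_def)
  have "det ?A = (\<Sum>j<n + Suc m. ?A $$ (?l, j) * cofactor ?A ?l j)"
    by (rule laplace_expansion_row[OF A]) simp
  also have "\<dots> = (\<Sum>j<n + Suc m. if j = ?l then cofactor ?A ?l ?l else 0)"
    using Suc.prems by (intro sum.cong) auto
  also have "\<dots> = det (mat_delete ?A ?l ?l)"
    by (simp add: cofactor_def power_add[symmetric] mult_2[symmetric] del: power_add)
  finally show ?case
    using Suc.IH[of ?X] Suc.prems by (simp add: del)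
qed

text \<open>Both \<open>?L * ?U\<close> and \<open>?V * ?L\<close> are the block matrix with rows
  (1, -A) and (B, 1). Since det L = 1, comparing determinants involves no division, so this works
  over every commutative ring.\<close>

lemma det_one_plus_mult_commute:
  fixes A B :: "'a::comm_ring_1 mat"
  assumes A: "A \<in> carrier_mat n m" and B: "B \<in> carrier_mat m n"
  shows "det (1\<^sub>m n + A * B) = det (1\<^sub>m m + B * A)"
proof -
  let ?L = "four_block_mat (1\<^sub>m n) (0\<^sub>m n m) B (1\<^sub>m m)"
  let ?U = "four_block_mat (1\<^sub>m n) (- A) (0\<^sub>m m n) (1\<^sub>m m + B * A)"
  let ?V = "four_block_mat (1\<^sub>m n + A * B) (- A) (0\<^sub>m m n) (1\<^sub>m m)"
  have L: "?L \<in> carrier_mat (n + m) (n + m)" and U: "?U \<in> carrier_mat (n + m) (n + m)"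
    and V: "?V \<in> carrier_mat (n + m) (n + m)"
    using A B by (auto intro!: four_block_carrier_mat)
  have eq: "?L * ?U = ?V * ?L"
    using A B by (subst (1 2) mult_four_block_mat[where ?nr1.0 = n and ?n1.0 = n and ?n2.0 = m and ?nr2.0 = m and ?nc1.0 = n and ?nc2.0 = m])
      (auto simp: add.assoc intro!: cong_four_block_mat)
  have detL: "det ?L = 1"
    using B by (subst det_lower_triangular[OF _ L]) (auto simp: prod_list_diag_prod intro!: prod.neutral)
  have "det (?L * ?U) = det (?V * ?L)"
    by (simp only: eq)
  then show ?thesis
    using A B by (simp add: det_mult[OF L U] det_mult[OF V L] detL det_four_block_upper_left_one det_four_block_lower_right_one)
qed

section \<open>Jacobi's formula for matrices of power series\<close>

lemma fps_deriv_prod: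
  fixes f :: "'b \<Rightarrow> 'a::comm_ring_1 fps"
  assumes "finite I"
  shows "fps_deriv (\<Prod>i\<in>I. f i) = (\<Sum>i\<in>I. fps_deriv (f i) * (\<Prod>j\<in>I - {i}. f j))"
  using assms
proof (induction I)
  case (insert a I)
  have "(\<Sum>i\<in>I. fps_deriv (f i) * (\<Prod>j\<in>insert a I - {i}. f j))
      = (\<Sum>i\<in>I. f a * (fps_deriv (f i) * (\<Prod>j\<in>I - {i}. f j)))"
  proof (rule sum.cong[OF refl])
    fix i assume "i \<in> I"
    then have "insert a I - {i} = insert a (I - {i})" using insert by auto
    then show "fps_deriv (f i) * (\<Prod>j\<in>insert a I - {i}. f j) = f a * (fps_deriv (f i) * (\<Prod>j\<in>I - {i}. f j))"
      using insert by (simp add: algebra_simps)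
  qed
  moreover have "insert a I - {a} = I" using insert by auto
  ultimately show ?case
    using insert by (simp add: sum_distrib_left algebra_simps)
qed simp

text \<open>Differentiating the Leibniz expansion differentiates one row at a time, and
  \<open>?R k\<close> is \<open>A\<close> with row k differentiated. Expanding
  \<open>det (?R k)\<close> along that row yields cofactors of \<open>A\<close> itself, since these
  do not see row k.\<close>

lemma fps_deriv_det:
  fixes A :: "'a::comm_ring_1 fps mat"
  assumes A: "A \<in> carrier_mat n n"
  shows "fps_deriv (det A) = (\<Sum>i<n. \<Sum>j<n. fps_deriv (A $$ (i, j)) * cofactor A i j)"
proof -
  let ?R = "\<lambda>k. mat n n (\<lambda>(i, j). if i = k then fps_deriv (A $$ (i, j)) else A $$ (i, j))"
  let ?P = "{p. p permutes {0..<n}}"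
  have R: "?R k \<in> carrier_mat n n" for k by simp
  have row: "det (?R k) = (\<Sum>j<n. fps_deriv (A $$ (k, j)) * cofactor A k j)" if "k < n" for k
  proof -
    have "mat_delete (?R k) k j = mat_delete A k j" if "j < n" for j
      using A \<open>k < n\<close> that by (intro eq_matI) (auto simp: mat_delete_def)
    then show ?thesis
      using that by (subst laplace_expansion_row[OF R that]) (auto simp: cofactor_def intro!: sum.cong)
  qed
  have "fps_deriv (det A) = (\<Sum>p\<in>?P. signof p * fps_deriv (\<Prod>i=0..<n. A $$ (i, p i)))"
    using A by (simp add: det_def fps_deriv_sum sign_def)
  also have "\<dots> = (\<Sum>p\<in>?P. \<Sum>k=0..<n. signof p * (\<Prod>i=0..<n. ?R k $$ (i, p i)))"
  proof (rule sum.cong[OF refl])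
    fix p assume "p \<in> ?P"
    then have p: "p i < n" if "i < n" for i
      using that permutes_in_image[of p "{0..<n}" i] by auto
    have "(\<Prod>i=0..<n. ?R k $$ (i, p i)) = fps_deriv (A $$ (k, p k)) * (\<Prod>j\<in>{0..<n} - {k}. A $$ (j, p j))"
      if "k < n" for k
      using that p by (subst prod.remove[of _ k]) (auto intro!: prod.cong arg_cong2[where f = "(*)"])
    then show "signof p * fps_deriv (\<Prod>i=0..<n. A $$ (i, p i)) = (\<Sum>k=0..<n. signof p * (\<Prod>i=0..<n. ?R k $$ (i, p i)))"
      by (simp add: fps_deriv_prod sum_distrib_left)
  qed
  also have "\<dots> = (\<Sum>k=0..<n. det (?R k))"
    by (subst sum.swap) (simp add: det_def)
  finally show ?thesis
    by (simp add: row atLeast0LessThan)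
qed

text \<open>Writing A' = A W instead of W = A^(-1) A' avoids inverting A: the trace of adj(A) A W is
  det(A) times the trace of W, because adj(A) A is the scalar matrix det(A).\<close>

lemma fps_deriv_det_logarithmic:
  fixes A W :: "'a::comm_ring_1 fps mat"
  assumes A: "A \<in> carrier_mat n n" and W: "W \<in> carrier_mat n n"
    and deriv: "map_mat fps_deriv A = A * W"
  shows "fps_deriv (det A) = det A * (\<Sum>i<n. W $$ (i, i))"
proof -
  have adj: "(\<Sum>i<n. adj_mat A $$ (j, i) * A $$ (i, k)) = (if j = k then det A else 0)"
    if "j < n" "k < n" for j k
  proof -
    have "(\<Sum>i<n. adj_mat A $$ (j, i) * A $$ (i, k)) = (adj_mat A * A) $$ (j, k)"
      using that A adj_mat(1)[OF A] by (simp add: scalar_prod_def atLeast0LessThan)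
    then show ?thesis
      by (simp add: adj_mat(3)[OF A] that)
  qed
  have "fps_deriv (A $$ (i, j)) = (\<Sum>k<n. A $$ (i, k) * W $$ (k, j))" if "i < n" "j < n" for i j
    using that A W arg_cong[OF deriv, of "\<lambda>B. B $$ (i, j)"]
    by (auto simp: scalar_prod_def atLeast0LessThan)
  then have "fps_deriv (det A) = (\<Sum>i<n. \<Sum>j<n. (\<Sum>k<n. A $$ (i, k) * W $$ (k, j)) * adj_mat A $$ (j, i))"
    using A by (simp add: fps_deriv_det adj_mat_def)
  also have "\<dots> = (\<Sum>j<n. \<Sum>k<n. \<Sum>i<n. W $$ (k, j) * (adj_mat A $$ (j, i) * A $$ (i, k)))"
    unfolding sum_distrib_right
    by (subst sum.swap, rule sum.cong[OF refl], subst sum.swap) (simp add: algebra_simps)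
  also have "\<dots> = (\<Sum>j<n. \<Sum>k<n. if j = k then W $$ (j, j) * det A else 0)"
    unfolding sum_distrib_left[symmetric] by (intro sum.cong refl) (simp add: adj)
  also have "\<dots> = det A * (\<Sum>i<n. W $$ (i, i))"
    by (simp add: sum_distrib_left mult.commute)
  finally show ?thesis .
qed

section \<open>Traces and determinants from dual bases\<close>

locale unital_subring =
  fixes S :: "'r::comm_ring_1 set"
  assumes zero_mem: "0 \<in> S" and one_mem: "1 \<in> S"
    and add_mem: "a \<in> S \<Longrightarrow> b \<in> S \<Longrightarrow> a + b \<in> S"
    and uminus_mem: "a \<in> S \<Longrightarrow> - a \<in> S"
    and mult_mem: "a \<in> S \<Longrightarrow> b \<in> S \<Longrightarrow> a * b \<in> S"
begin

lemma diff_mem: "a \<in> S \<Longrightarrow> b \<in> S \<Longrightarrow> a - b \<in> S"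
  using add_mem[OF _ uminus_mem, of a b] by simp

lemma sum_mem: "(\<And>i. i \<in> I \<Longrightarrow> f i \<in> S) \<Longrightarrow> sum f I \<in> S"
  by (induction I rule: infinite_finite_induct) (auto intro: zero_mem add_mem)

lemma ring_on_simps:
  "carrier (ring_on S) = S" "\<zero>\<^bsub>ring_on S\<^esub> = 0" "\<one>\<^bsub>ring_on S\<^esub> = 1"
  "a \<oplus>\<^bsub>ring_on S\<^esub> b = a + b" "a \<otimes>\<^bsub>ring_on S\<^esub> b = a * b"
  by (simp_all add: ring_on_def)

lemma cring_ring_on: "cring (ring_on S)"
proof (rule cringI)
  show "abelian_group (ring_on S)"
    by (rule abelian_groupI)
      (auto simp: ring_on_simps add_mem zero_mem add_ac intro: exI bexI[where x = "- x" for x] uminus_mem)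
  show "comm_monoid (ring_on S)"
    by (rule comm_monoidI) (auto simp: ring_on_simps mult_mem one_mem mult_ac)
qed (auto simp: ring_on_simps algebra_simps)

end

text \<open>
  \<open>coord_inject\<close> and \<open>coord_expand\<close> say that \<open>x = (\<Sum>j<n. coord j x * gen j)\<close>. Phrasing this in the
  scalars avoids sums in \<open>M\<close>, so that the module axioms can be derived from it.
\<close>

locale dual_basis = unital_subring S
  for S :: "'r::comm_ring_1 set" +
  fixes M :: "('r, 'm) module" and n :: nat and gen :: "nat \<Rightarrow> 'm" and coord :: "nat \<Rightarrow> 'm \<Rightarrow> 'r"
  assumes zero_closed: "\<zero>\<^bsub>M\<^esub> \<in> carrier M"
    and add_closed: "x \<in> carrier M \<Longrightarrow> y \<in> carrier M \<Longrightarrow> x \<oplus>\<^bsub>M\<^esub> y \<in> carrier M"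
    and smult_closed: "a \<in> S \<Longrightarrow> x \<in> carrier M \<Longrightarrow> a \<odot>\<^bsub>M\<^esub> x \<in> carrier M"
    and gen_closed: "i < n \<Longrightarrow> gen i \<in> carrier M"
    and coord_mem: "i < n \<Longrightarrow> x \<in> carrier M \<Longrightarrow> coord i x \<in> S"
    and coord_zero: "i < n \<Longrightarrow> coord i \<zero>\<^bsub>M\<^esub> = 0"
    and coord_add: "i < n \<Longrightarrow> x \<in> carrier M \<Longrightarrow> y \<in> carrier M \<Longrightarrow>
      coord i (x \<oplus>\<^bsub>M\<^esub> y) = coord i x + coord i y"
    and coord_smult: "i < n \<Longrightarrow> a \<in> S \<Longrightarrow> x \<in> carrier M \<Longrightarrow> coord i (a \<odot>\<^bsub>M\<^esub> x) = a * coord i x"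
    and coord_inject: "x \<in> carrier M \<Longrightarrow> y \<in> carrier M \<Longrightarrow>
      (\<And>i. i < n \<Longrightarrow> coord i x = coord i y) \<Longrightarrow> x = y"
    and coord_expand: "i < n \<Longrightarrow> x \<in> carrier M \<Longrightarrow>
      coord i x = (\<Sum>j<n. coord j x * coord i (gen j))"
begin

sublocale M: module "ring_on S" M
proof (rule moduleI)
  show "cring (ring_on S)"
    by (rule cring_ring_on)
  \<comment> \<open>The scalar -1 supplies additive inverses; the identity is then checked in
    coordinates.\<close>
  have inverse: "\<exists>y\<in>carrier M. y \<oplus>\<^bsub>M\<^esub> x = \<zero>\<^bsub>M\<^esub>" if "x \<in> carrier M" for x
    using that uminus_mem[OF one_mem]
    by (intro bexI[of _ "(- 1) \<odot>\<^bsub>M\<^esub> x"] coord_inject)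
      (auto simp: smult_closed add_closed zero_closed coord_add coord_smult coord_zero)
  show "abelian_group M"
    by (rule abelian_groupI)
      (auto intro!: coord_inject inverse simp: add_closed zero_closed coord_add coord_zero add_ac)
qed (auto intro!: coord_inject simp: ring_on_simps coord_add coord_smult add_closed smult_closed
    one_mem add_mem mult_mem algebra_simps)

lemma coord_finsum:
  assumes "i < n" "finite I" "f \<in> I \<rightarrow> carrier M"
  shows "coord i (finsum M f I) = (\<Sum>k\<in>I. coord i (f k))"
  using assms(2,3)
  by (induction I) (auto simp: coord_zero coord_add assms(1) Pi_def M.finsum_closed)

lemma expand:
  assumes "x \<in> carrier M"
  shows "x = (\<Oplus>\<^bsub>M\<^esub>j\<in>{..<n}. coord j x \<odot>\<^bsub>M\<^esub> gen j)"
proof -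
  have closed: "(\<lambda>j. coord j x \<odot>\<^bsub>M\<^esub> gen j) \<in> {..<n} \<rightarrow> carrier M"
    using assms by (auto intro: smult_closed coord_mem gen_closed)
  then show ?thesis
    using assms coord_expand[of _ x, symmetric] by (intro coord_inject M.finsum_closed)
      (auto simp: coord_finsum coord_smult coord_mem gen_closed)
qed

text \<open>Linearity expressed in coordinates, which is the form that the trace and determinant
  formulas use. For an operator on \<complex>X given by a matrix it follows from matrix
  multiplication, and \<open>endoI\<close> derives it from linearity in the usual sense.\<close>

definition endo :: "('m \<Rightarrow> 'm) \<Rightarrow> bool" where
  "endo f \<longleftrightarrow> f \<in> carrier M \<rightarrow> carrier M \<and>
     (\<forall>i<n. \<forall>x\<in>carrier M. coord i (f x) = (\<Sum>j<n. coord j x * coord i (f (gen j))))"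

lemma endo_id: "endo (\<lambda>x. x)"
  unfolding endo_def by (auto intro: coord_expand)

end

text \<open>
  Both determinants are of the form \<open>1 + X * Y\<close> and \<open>1 + Y * X\<close> for rectangular matrices over the
  two systems of coordinates.
\<close>

lemma dual_basis_change:
  fixes M :: "('r::comm_ring_1, 'm) module"
  assumes "dual_basis S M n gen coord" "dual_basis S M n' gen' coord'" "dual_basis.endo M n gen coord f"
  shows "det (mat n' n' (\<lambda>(i, j). (if i = j then 1 else 0) - coord' i (gen' j) + coord' i (f (gen' j))))
       = det (mat n n (\<lambda>(i, j). (if i = j then 1 else 0) - coord i (gen j) + coord i (f (gen j))))"
    and "(\<Sum>i<n'. coord' i (f (gen' i))) = (\<Sum>i<n. coord i (f (gen i)))"
proof -
  interpret A: dual_basis S M n gen coord by fact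
  interpret B: dual_basis S M n' gen' coord' by fact
  have f: "f x \<in> carrier M" if "x \<in> carrier M" for x
    using assms(3) that by (auto simp: A.endo_def)
  have AB: "coord i x = (\<Sum>j<n'. coord' j x * coord i (gen' j))" if "i < n" "x \<in> carrier M" for i x
    using that A.coord_finsum[of i "{..<n'}" "\<lambda>j. coord' j x \<odot>\<^bsub>M\<^esub> gen' j"]
    by (simp add: B.expand[symmetric] A.smult_closed A.coord_smult B.coord_mem B.gen_closed Pi_def)
  have BA: "coord' i x = (\<Sum>j<n. coord j x * coord' i (gen j))" if "i < n'" "x \<in> carrier M" for i x
    using that B.coord_finsum[of i "{..<n}" "\<lambda>j. coord j x \<odot>\<^bsub>M\<^esub> gen j"]
    by (simp add: A.expand[symmetric] A.smult_closed B.coord_smult A.coord_mem A.gen_closed Pi_def)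
  \<comment> \<open>Linearity of f is given in the first system only; expanding through that system
    transports it to the second coordinates.\<close>
  have fBA: "coord' i (f x) = (\<Sum>j<n. coord j x * coord' i (f (gen j)))"
    if i: "i < n'" and x: "x \<in> carrier M" for i x
  proof -
    have "coord' i (f x) = (\<Sum>k<n. (\<Sum>j<n. coord j x * coord k (f (gen j))) * coord' i (gen k))"
      using assms(3) x by (subst BA[OF i f[OF x]]) (auto simp: A.endo_def)
    also have "\<dots> = (\<Sum>j<n. coord j x * (\<Sum>k<n. coord k (f (gen j)) * coord' i (gen k)))"
      unfolding sum_distrib_left sum_distrib_right by (subst sum.swap) (simp add: mult.assoc)
    also have "\<dots> = (\<Sum>j<n. coord j x * coord' i (f (gen j)))"
      using i by (intro sum.cong refl) (simp add: BA[symmetric] f A.gen_closed)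
    finally show ?thesis .
  qed
  \<comment> \<open>\<open>?X\<close> writes the second generators in the first coordinates, and
    \<open>?Y\<close> is the matrix of f - 1 from the first generators to the second coordinates.
    Hence \<open>?X * ?Y\<close> is F - P for the first system and \<open>?Y * ?X\<close> is F - P
    for the second.\<close>
  let ?X = "mat n n' (\<lambda>(i, j). coord i (gen' j))"
  let ?Y = "mat n' n (\<lambda>(i, j). coord' i (f (gen j)) - coord' i (gen j))"
  have XY: "1\<^sub>m n + ?X * ?Y = mat n n (\<lambda>(i, j). (if i = j then 1 else 0) - coord i (gen j) + coord i (f (gen j)))"
  proof (rule eq_matI)
    fix i j assume ij: "i < dim_row (mat n n (\<lambda>(i, j). (if i = j then 1 else 0) - coord i (gen j) + coord i (f (gen j))))"
      "j < dim_col (mat n n (\<lambda>(i, j). (if i = j then 1 else 0) - coord i (gen j) + coord i (f (gen j))))"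
    have "(\<Sum>k<n'. coord i (gen' k) * (coord' k (f (gen j)) - coord' k (gen j))) = coord i (f (gen j)) - coord i (gen j)"
      using ij by (simp add: AB[of i "f (gen j)"] AB[of i "gen j"] f A.gen_closed sum_subtractf[symmetric] algebra_simps)
    then show "(1\<^sub>m n + ?X * ?Y) $$ (i, j) = mat n n (\<lambda>(i, j). (if i = j then 1 else 0) - coord i (gen j) + coord i (f (gen j))) $$ (i, j)"
      using ij by (simp add: scalar_prod_def atLeast0LessThan)
  qed auto
  have YX: "1\<^sub>m n' + ?Y * ?X = mat n' n' (\<lambda>(i, j). (if i = j then 1 else 0) - coord' i (gen' j) + coord' i (f (gen' j)))"
  proof (rule eq_matI)
    fix i j assume ij: "i < dim_row (mat n' n' (\<lambda>(i, j). (if i = j then 1 else 0) - coord' i (gen' j) + coord' i (f (gen' j))))"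
      "j < dim_col (mat n' n' (\<lambda>(i, j). (if i = j then 1 else 0) - coord' i (gen' j) + coord' i (f (gen' j))))"
    have "(\<Sum>k<n. (coord' i (f (gen k)) - coord' i (gen k)) * coord k (gen' j)) = coord' i (f (gen' j)) - coord' i (gen' j)"
      using ij by (simp add: fBA[of i "gen' j"] BA[of i "gen' j"] B.gen_closed sum_subtractf[symmetric] algebra_simps)
    then show "(1\<^sub>m n' + ?Y * ?X) $$ (i, j) = mat n' n' (\<lambda>(i, j). (if i = j then 1 else 0) - coord' i (gen' j) + coord' i (f (gen' j))) $$ (i, j)"
      using ij by (simp add: scalar_prod_def atLeast0LessThan)
  qed auto
  show "det (mat n' n' (\<lambda>(i, j). (if i = j then 1 else 0) - coord' i (gen' j) + coord' i (f (gen' j))))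
       = det (mat n n (\<lambda>(i, j). (if i = j then 1 else 0) - coord i (gen j) + coord i (f (gen j))))"
    unfolding XY[symmetric] YX[symmetric] by (rule det_one_plus_mult_commute[symmetric]) auto
  have "(\<Sum>i<n'. coord' i (f (gen' i))) = (\<Sum>i<n'. \<Sum>j<n. coord j (gen' i) * coord' i (f (gen j)))"
    by (intro sum.cong refl fBA) (auto intro: B.gen_closed)
  also have "\<dots> = (\<Sum>j<n. \<Sum>i<n'. coord' i (f (gen j)) * coord j (gen' i))"
    by (subst sum.swap) (simp add: mult.commute)
  also have "\<dots> = (\<Sum>i<n. coord i (f (gen i)))"
    by (intro sum.cong refl AB[symmetric]) (auto intro: f A.gen_closed)
  finally show "(\<Sum>i<n'. coord' i (f (gen' i))) = (\<Sum>i<n. coord i (f (gen i)))" .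
qed

text \<open>Bridge from \<open>finsum\<close> in a module to sums in a type class. T is later a
  coordinate function, possibly composed with a component of a direct sum, and is additive on the
  carrier only.\<close>

lemma (in abelian_monoid) additive_finsum:
  fixes T :: "'a \<Rightarrow> 'c::comm_monoid_add"
  assumes "T \<zero> = 0" "\<And>x y. x \<in> carrier G \<Longrightarrow> y \<in> carrier G \<Longrightarrow> T (x \<oplus> y) = T x + T y"
    and "finite I" "f \<in> I \<rightarrow> carrier G"
  shows "T (finsum G f I) = (\<Sum>k\<in>I. T (f k))"
  using assms(3,4) by (induction I) (auto simp: assms(1,2) Pi_def finsum_closed)

text \<open>A basis is a dual basis with P = 1. Every property of the coordinates comes from
  uniqueness: scalars that represent x must be its coordinates.\<close>

lemma is_basis_imp_dual_basis:
  fixes D :: "('r::comm_ring_1, 'm) module"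
  assumes "unital_subring S" "module (ring_on S) D" "is_basis S D n b"
  shows "dual_basis S D n b (\<lambda>i x. (THE c. is_coords S D n b x c) i)"
    and "i < n \<Longrightarrow> j < n \<Longrightarrow> (THE c. is_coords S D n b (b j) c) i = (if i = j then 1 else 0)"
proof -
  interpret unital_subring S by fact
  interpret D: module "ring_on S" D by fact
  note [simp] = ring_on_simps
  have b: "b i \<in> carrier D" if "i < n" for i
    using assms(3) that by (auto simp: is_basis_def)
  define cc where "cc x = (THE c. is_coords S D n b x c)" for x
  have ex1: "\<exists>!c. is_coords S D n b x c" if "x \<in> carrier D" for x
    using assms(3) that by (auto simp: is_basis_def)
  have cc: "is_coords S D n b x (cc x)" if "x \<in> carrier D" for x
    unfolding cc_def by (rule theI'[OF ex1[OF that]])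
  have ccI: "cc x = c" if "x \<in> carrier D" "is_coords S D n b x c" for x c
    using ex1[OF that(1)] cc[OF that(1)] that(2) by blast
  have cS: "cc x i \<in> S" if "x \<in> carrier D" "i < n" for x i
    using cc[OF that(1)] that(2) by (auto simp: is_coords_def PiE_def)
  have cx: "(\<Oplus>\<^bsub>D\<^esub>i\<in>{..<n}. cc x i \<odot>\<^bsub>D\<^esub> b i) = x" if "x \<in> carrier D" for x
    using cc[OF that] by (simp add: is_coords_def)
  \<comment> \<open>Uniqueness in \<open>is_basis\<close> is about functions extensional on
    \<open>{..<n}\<close>, hence the restriction of c.\<close>
  have eval: "cc x i = c i"
    if "x \<in> carrier D" "\<And>i. i < n \<Longrightarrow> c i \<in> S" "x = (\<Oplus>\<^bsub>D\<^esub>i\<in>{..<n}. c i \<odot>\<^bsub>D\<^esub> b i)" "i < n" for x c i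
  proof -
    have "(\<Oplus>\<^bsub>D\<^esub>i\<in>{..<n}. restrict c {..<n} i \<odot>\<^bsub>D\<^esub> b i) = (\<Oplus>\<^bsub>D\<^esub>i\<in>{..<n}. c i \<odot>\<^bsub>D\<^esub> b i)"
      using that(2) by (intro D.M.finsum_cong') (auto intro: b D.smult_closed)
    then have "is_coords S D n b x (restrict c {..<n})"
      using that by (auto simp: is_coords_def)
    then show ?thesis
      using ccI[OF that(1)] that(4) by simp
  qed
  have add: "cc (x \<oplus>\<^bsub>D\<^esub> y) i = cc x i + cc y i" if "i < n" "x \<in> carrier D" "y \<in> carrier D" for x y i
  proof (rule eval)
    have "(\<Oplus>\<^bsub>D\<^esub>i\<in>{..<n}. (cc x i + cc y i) \<odot>\<^bsub>D\<^esub> b i)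
      = (\<Oplus>\<^bsub>D\<^esub>i\<in>{..<n}. cc x i \<odot>\<^bsub>D\<^esub> b i \<oplus>\<^bsub>D\<^esub> cc y i \<odot>\<^bsub>D\<^esub> b i)"
      using that by (intro D.M.finsum_cong') (auto simp: D.smult_l_distr[simplified] cS b)
    also have "\<dots> = (\<Oplus>\<^bsub>D\<^esub>i\<in>{..<n}. cc x i \<odot>\<^bsub>D\<^esub> b i) \<oplus>\<^bsub>D\<^esub> (\<Oplus>\<^bsub>D\<^esub>i\<in>{..<n}. cc y i \<odot>\<^bsub>D\<^esub> b i)"
      using that by (intro D.M.finsum_addf) (auto simp: cS b)
    finally show "x \<oplus>\<^bsub>D\<^esub> y = (\<Oplus>\<^bsub>D\<^esub>i\<in>{..<n}. (cc x i + cc y i) \<odot>\<^bsub>D\<^esub> b i)"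
      using that by (simp add: cx)
  qed (use that in \<open>auto simp: cS add_mem\<close>)
  have zero: "cc \<zero>\<^bsub>D\<^esub> i = 0" if "i < n" for i
    using add[OF that, of "\<zero>\<^bsub>D\<^esub>" "\<zero>\<^bsub>D\<^esub>"] by simp
  have smult: "cc (a \<odot>\<^bsub>D\<^esub> x) i = a * cc x i" if "i < n" "a \<in> S" "x \<in> carrier D" for a x i
  proof (rule eval)
    have "(\<Oplus>\<^bsub>D\<^esub>i\<in>{..<n}. (a * cc x i) \<odot>\<^bsub>D\<^esub> b i) = (\<Oplus>\<^bsub>D\<^esub>i\<in>{..<n}. a \<odot>\<^bsub>D\<^esub> (cc x i \<odot>\<^bsub>D\<^esub> b i))"
      using that by (intro D.M.finsum_cong') (auto simp: D.smult_assoc1[simplified] cS b)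
    also have "\<dots> = a \<odot>\<^bsub>D\<^esub> (\<Oplus>\<^bsub>D\<^esub>i\<in>{..<n}. cc x i \<odot>\<^bsub>D\<^esub> b i)"
      using that by (intro D.finsum_smult_ldistr[symmetric]) (auto simp: cS b)
    finally show "a \<odot>\<^bsub>D\<^esub> x = (\<Oplus>\<^bsub>D\<^esub>i\<in>{..<n}. (a * cc x i) \<odot>\<^bsub>D\<^esub> b i)"
      using that by (simp add: cx)
  qed (use that in \<open>auto simp: cS mult_mem\<close>)
  have delta: "cc (b j) i = (if i = j then 1 else 0)" if "i < n" "j < n" for i j
  proof (rule eval)
    have "(\<Oplus>\<^bsub>D\<^esub>i\<in>{..<n}. (if i = j then 1 else 0) \<odot>\<^bsub>D\<^esub> b i) = (\<Oplus>\<^bsub>D\<^esub>i\<in>{..<n}. if j = i then b i else \<zero>\<^bsub>D\<^esub>)"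
      using that by (intro D.M.finsum_cong') (auto simp: D.smult_l_null[simplified] D.smult_one[simplified] b)
    also have "\<dots> = b j"
      using that b by (intro D.M.finsum_singleton) auto
    finally show "b j = (\<Oplus>\<^bsub>D\<^esub>i\<in>{..<n}. (if i = j then 1 else 0) \<odot>\<^bsub>D\<^esub> b i)" ..
  qed (use that in \<open>auto simp: b zero_mem one_mem\<close>)
  show "dual_basis S D n b (\<lambda>i x. (THE c. is_coords S D n b x c) i)"
    unfolding cc_def[symmetric]
  proof
    fix x y assume xy: "x \<in> carrier D" "y \<in> carrier D" "\<And>i. i < n \<Longrightarrow> cc x i = cc y i"
    have "x = (\<Oplus>\<^bsub>D\<^esub>i\<in>{..<n}. cc x i \<odot>\<^bsub>D\<^esub> b i)"
      using xy by (simp add: cx)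
    also have "\<dots> = (\<Oplus>\<^bsub>D\<^esub>i\<in>{..<n}. cc y i \<odot>\<^bsub>D\<^esub> b i)"
      using xy by (intro D.M.finsum_cong') (auto simp: cS b)
    finally show "x = y"
      using xy by (simp add: cx)
  next
    fix i x assume "i < n" "x \<in> carrier D"
    have "(\<Sum>j<n. cc x j * cc (b j) i) = (\<Sum>j<n. if j = i then cc x j else 0)"
      using \<open>i < n\<close> by (intro sum.cong) (auto simp: delta)
    then show "cc x i = (\<Sum>j<n. cc x j * cc (b j) i)"
      using \<open>i < n\<close> by simp
  qed (simp_all add: b cS zero add smult)
  show "(THE c. is_coords S D n b (b j) c) i = (if i = j then 1 else 0)" if "i < n" "j < n"
    using delta[OF that] by (simp add: cc_def)
qed

section \<open>Direct summands of free modules\<close>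

context dual_basis
begin

lemma direct_summand_dual_basis:
  fixes N :: "('r, 'k) module" and b :: "nat \<Rightarrow> 'm \<times> 'k"
  assumes N: "module (ring_on S) N" and basis: "is_basis S (direct_sum M N) l b"
  defines "crd \<equiv> \<lambda>i x. (THE c. is_coords S (direct_sum M N) l b (x, \<zero>\<^bsub>N\<^esub>) c) i"
  shows "dual_basis S M l (\<lambda>i. fst (b i)) crd"
    and "f \<in> carrier M \<rightarrow> carrier M \<Longrightarrow> endo_mat S (direct_sum M N) l b (\<lambda>(x, y). (f x, y))
       = mat l l (\<lambda>(i, j). (if i = j then 1 else 0) - crd i (fst (b j)) + crd i (f (fst (b j))))"
    and "f \<in> carrier M \<rightarrow> carrier M \<Longrightarrow> i < l \<Longrightarrow>
       endo_mat S (direct_sum M N) l b (\<lambda>(x, y). (f x, \<zero>\<^bsub>N\<^esub>)) $$ (i, i) = crd i (f (fst (b i)))"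
proof -
  let ?D = "direct_sum M N"
  interpret N: module "ring_on S" N by fact
  have D: "module (ring_on S) ?D"
    using M.module_axioms N by (rule direct_sum_is_module)
  define C where "C i z = (THE c. is_coords S ?D l b z c) i" for i z
  interpret D: dual_basis S ?D l b C
    unfolding C_def using is_basis_imp_dual_basis(1)[OF unital_subring_axioms D basis] .
  have crd: "crd i x = C i (x, \<zero>\<^bsub>N\<^esub>)" for i x
    by (simp add: crd_def C_def)
  have carD: "z \<in> carrier ?D \<longleftrightarrow> fst z \<in> carrier M \<and> snd z \<in> carrier N" for z
    by (cases z) (simp add: direct_sum_def)
  have addD: "z \<oplus>\<^bsub>?D\<^esub> w = (fst z \<oplus>\<^bsub>M\<^esub> fst w, snd z \<oplus>\<^bsub>N\<^esub> snd w)" for z w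
    by (simp add: direct_sum_def)
  have smultD: "a \<odot>\<^bsub>?D\<^esub> z = (a \<odot>\<^bsub>M\<^esub> fst z, a \<odot>\<^bsub>N\<^esub> snd z)" for a z
    by (simp add: direct_sum_def)
  have zeroD: "\<zero>\<^bsub>?D\<^esub> = (\<zero>\<^bsub>M\<^esub>, \<zero>\<^bsub>N\<^esub>)"
    by (simp add: direct_sum_def)
  have b: "fst (b i) \<in> carrier M" "snd (b i) \<in> carrier N" if "i < l" for i
    using D.gen_closed[OF that] by (simp_all add: carD)
  have add: "crd i (x \<oplus>\<^bsub>M\<^esub> y) = crd i x + crd i y" if "i < l" "x \<in> carrier M" "y \<in> carrier M" for i x y
    using that D.coord_add[of i "(x, \<zero>\<^bsub>N\<^esub>)" "(y, \<zero>\<^bsub>N\<^esub>)"] by (simp add: carD addD crd)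
  have smult: "crd i (a \<odot>\<^bsub>M\<^esub> x) = a * crd i x" if "i < l" "a \<in> S" "x \<in> carrier M" for i a x
    using that D.coord_smult[of i a "(x, \<zero>\<^bsub>N\<^esub>)"] N.smult_r_null[of a]
    by (simp add: carD smultD crd ring_on_simps)
  have zero: "crd i \<zero>\<^bsub>M\<^esub> = 0" if "i < l" for i
    using that D.coord_zero[of i] by (simp add: zeroD crd)
  have mem: "crd i x \<in> S" if "i < l" "x \<in> carrier M" for i x
    using that by (simp add: crd carD D.coord_mem)
  show "dual_basis S M l (\<lambda>i. fst (b i)) crd"
  proof
    fix x y assume "x \<in> carrier M" "y \<in> carrier M" "\<And>i. i < l \<Longrightarrow> crd i x = crd i y"
    then have "(x, \<zero>\<^bsub>N\<^esub>) = (y, \<zero>\<^bsub>N\<^esub>)"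
      by (intro D.coord_inject) (auto simp: carD crd)
    then show "x = y" by simp
  next
    fix i x assume i: "i < l" and x: "x \<in> carrier M"
    let ?z = "(x, \<zero>\<^bsub>N\<^esub>)"
    have z: "?z \<in> carrier ?D" using x by (simp add: carD)
    have "crd i (fst ?z) = crd i (fst (\<Oplus>\<^bsub>?D\<^esub>j\<in>{..<l}. C j ?z \<odot>\<^bsub>?D\<^esub> b j))"
      using D.expand[OF z] by simp
    also have "\<dots> = (\<Sum>j<l. crd i (fst (C j ?z \<odot>\<^bsub>?D\<^esub> b j)))"
      using i z by (intro D.M.additive_finsum)
        (auto simp: zeroD zero addD add carD smultD b D.coord_mem intro!: smult_closed N.smult_closed simp: ring_on_simps)
    also have "\<dots> = (\<Sum>j<l. crd j x * crd i (fst (b j)))"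
      using i D.coord_mem[OF _ z] by (intro sum.cong) (auto simp: smultD smult b crd[symmetric])
    finally show "crd i x = (\<Sum>j<l. crd j x * crd i (fst (b j)))" by simp
  qed (auto simp: add smult zero b smult_closed zero_closed add_closed mem)
  \<comment> \<open>Splits \<open>b j\<close> into its two components; the coordinates of
    \<open>b j\<close> itself form a unit vector.\<close>
  have delta: "C i (\<zero>\<^bsub>M\<^esub>, snd (b j)) = (if i = j then 1 else 0) - crd i (fst (b j))" if "i < l" "j < l" for i j
    using that D.coord_add[of i "(fst (b j), \<zero>\<^bsub>N\<^esub>)" "(\<zero>\<^bsub>M\<^esub>, snd (b j))"] b[of j]
      is_basis_imp_dual_basis(2)[OF unital_subring_axioms D basis that]
    by (simp add: carD addD crd zero_closed C_def[symmetric] algebra_simps)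
  show "endo_mat S ?D l b (\<lambda>(x, y). (f x, y))
       = mat l l (\<lambda>(i, j). (if i = j then 1 else 0) - crd i (fst (b j)) + crd i (f (fst (b j))))"
    if f: "f \<in> carrier M \<rightarrow> carrier M"
  proof -
    have "C i (f (fst (b j)), snd (b j)) = (if i = j then 1 else 0) - crd i (fst (b j)) + crd i (f (fst (b j)))"
      if "i < l" "j < l" for i j
    proof -
      have fb: "f (fst (b j)) \<in> carrier M"
        using f b[OF that(2)] by auto
      have "C i (f (fst (b j)), snd (b j)) = crd i (f (fst (b j))) + C i (\<zero>\<^bsub>M\<^esub>, snd (b j))"
        using that b[of j] fb D.coord_add[of i "(f (fst (b j)), \<zero>\<^bsub>N\<^esub>)" "(\<zero>\<^bsub>M\<^esub>, snd (b j))"]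
        by (simp add: carD addD crd zero_closed)
      then show ?thesis
        by (simp add: delta that)
    qed
    then show ?thesis
      unfolding endo_mat_def by (intro eq_matI) (auto simp: C_def[symmetric] case_prod_beta)
  qed
  show "endo_mat S ?D l b (\<lambda>(x, y). (f x, \<zero>\<^bsub>N\<^esub>)) $$ (i, i) = crd i (f (fst (b i)))"
    if "f \<in> carrier M \<rightarrow> carrier M" "i < l"
    using that by (simp add: endo_mat_def crd_def case_prod_beta)
qed

text \<open>N is the kernel of S^n \<rightarrow> M sending y to the sum of the y j * gen j. This map
  is split by x \<mapsto> (coord j x), so y \<mapsto> (image of y, y - P y) identifies S^n with the
  direct sum. \<open>b\<close> is the image of the standard basis, and the inverse takes (x, y) to
  coord x + y. Tuples vanish from n on, so that each is a single function on the naturals.\<close>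

lemma complement_exists:
  "\<exists>(N :: ('r, nat \<Rightarrow> 'r) module) b. module (ring_on S) N \<and> is_basis S (direct_sum M N) n b"
proof -
  define N :: "('r, nat \<Rightarrow> 'r) module" where
    "N = \<lparr>carrier = {y. (\<forall>i<n. y i \<in> S \<and> (\<Sum>j<n. y j * coord i (gen j)) = 0) \<and> (\<forall>i\<ge>n. y i = 0)},
      monoid.mult = undefined, one = undefined, zero = (\<lambda>_. 0), add = (\<lambda>y z i. y i + z i),
      smult = (\<lambda>a y i. a * y i)\<rparr>"
  define b where "b j = (gen j, \<lambda>i. if i < n then (if i = j then 1 else 0) - coord i (gen j) else 0)" for j
  have carN: "y \<in> carrier N \<longleftrightarrow> (\<forall>i<n. y i \<in> S \<and> (\<Sum>j<n. y j * coord i (gen j)) = 0) \<and> (\<forall>i\<ge>n. y i = 0)" for y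
    by (simp add: N_def)
  have N: "module (ring_on S) N"
  proof (rule moduleI)
    show "cring (ring_on S)" by (rule cring_ring_on)
    have inverse: "\<exists>y\<in>carrier N. y \<oplus>\<^bsub>N\<^esub> x = \<zero>\<^bsub>N\<^esub>" if "x \<in> carrier N" for x
      using that by (intro bexI[of _ "\<lambda>i. - x i"]) (auto simp: N_def uminus_mem sum_negf)
    show "abelian_group N"
      by (rule abelian_groupI)
        (auto intro!: inverse, auto simp: N_def add_mem zero_mem add_ac distrib_right sum.distrib)
  qed (auto simp: N_def ring_on_simps algebra_simps mult_mem sum_distrib_left[symmetric])
  interpret N: module "ring_on S" N by fact
  let ?D = "direct_sum M N"
  interpret D: module "ring_on S" ?D
    using M.module_axioms N by (rule direct_sum_is_module)
  have bN: "snd (b j) \<in> carrier N" if j: "j < n" for j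
  proof -
    have "(\<Sum>k<n. ((if k = j then 1 else 0) - coord k (gen j)) * coord i (gen k)) = 0" if i: "i < n" for i
    proof -
      have "(\<Sum>k<n. ((if k = j then 1 else 0) - coord k (gen j)) * coord i (gen k))
         = (\<Sum>k<n. if k = j then coord i (gen k) else 0) - (\<Sum>k<n. coord k (gen j) * coord i (gen k))"
        unfolding sum_subtractf[symmetric] by (intro sum.cong) (auto simp: algebra_simps)
      also have "\<dots> = 0"
        using i j by (simp add: coord_expand[OF i gen_closed[OF j], symmetric])
      finally show ?thesis .
    qed
    then show ?thesis
      using j by (auto simp: carN b_def diff_mem zero_mem one_mem coord_mem gen_closed uminus_mem)
  qed
  have bD: "b j \<in> carrier ?D" if "j < n" for j
    using that gen_closed bN by (simp add: direct_sum_def b_def)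
  have cb: "c j \<odot>\<^bsub>?D\<^esub> b j \<in> carrier ?D" if "c \<in> {..<n} \<rightarrow> S" "j < n" for c j
    using that bD by (intro D.smult_closed) (auto simp: ring_on_simps)
  have c1: "coord i (fst (\<Oplus>\<^bsub>?D\<^esub>j\<in>{..<n}. c j \<odot>\<^bsub>?D\<^esub> b j)) = (\<Sum>j<n. c j * coord i (gen j))"
    if "c \<in> {..<n} \<rightarrow> S" "i < n" for c i
  proof -
    have "coord i (fst (\<Oplus>\<^bsub>?D\<^esub>j\<in>{..<n}. c j \<odot>\<^bsub>?D\<^esub> b j)) = (\<Sum>j<n. coord i (fst (c j \<odot>\<^bsub>?D\<^esub> b j)))"
      using that cb by (intro D.M.additive_finsum) (auto simp: direct_sum_def coord_zero coord_add)
    also have "\<dots> = (\<Sum>j<n. c j * coord i (gen j))"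
      using that by (intro sum.cong) (auto simp: direct_sum_def b_def coord_smult gen_closed Pi_iff)
    finally show ?thesis .
  qed
  have c2: "snd (\<Oplus>\<^bsub>?D\<^esub>j\<in>{..<n}. c j \<odot>\<^bsub>?D\<^esub> b j) i = c i - (\<Sum>j<n. c j * coord i (gen j))"
    if "c \<in> {..<n} \<rightarrow> S" "i < n" for c i
  proof -
    have "snd (\<Oplus>\<^bsub>?D\<^esub>j\<in>{..<n}. c j \<odot>\<^bsub>?D\<^esub> b j) i = (\<Sum>j<n. snd (c j \<odot>\<^bsub>?D\<^esub> b j) i)"
      using that cb by (intro D.M.additive_finsum) (auto simp: direct_sum_def N_def)
    also have "\<dots> = (\<Sum>j<n. (if i = j then c j else 0) - c j * coord i (gen j))"
      using that by (intro sum.cong) (auto simp: direct_sum_def b_def N_def algebra_simps)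
    also have "\<dots> = c i - (\<Sum>j<n. c j * coord i (gen j))"
      using that by (simp add: sum_subtractf)
    finally show ?thesis .
  qed
  have "\<exists>!c. is_coords S ?D n b z c" if z: "z \<in> carrier ?D" for z
  proof (rule ex1I[of _ "\<lambda>i\<in>{..<n}. coord i (fst z) + snd z i"])
    define c where "c = (\<lambda>i\<in>{..<n}. coord i (fst z) + snd z i)"
    have ci: "c i = coord i (fst z) + snd z i" if "i < n" for i
      using that by (simp add: c_def)
    have x: "fst z \<in> carrier M" and y: "snd z \<in> carrier N"
      using z by (auto simp: direct_sum_def)
    have c: "c \<in> {..<n} \<rightarrow>\<^sub>E S"
      using x y by (auto simp: c_def carN add_mem coord_mem)
    then have c': "c \<in> {..<n} \<rightarrow> S" by (auto simp: PiE_def)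
    let ?w = "\<Oplus>\<^bsub>?D\<^esub>j\<in>{..<n}. c j \<odot>\<^bsub>?D\<^esub> b j"
    have "?w \<in> carrier ?D"
      using cb[OF c'] by (intro D.M.finsum_closed) auto
    then have w: "fst ?w \<in> carrier M" "snd ?w \<in> carrier N"
      by (auto simp: direct_sum_def)
    have s: "(\<Sum>j<n. c j * coord i (gen j)) = coord i (fst z)" if "i < n" for i
    proof -
      have "(\<Sum>j<n. c j * coord i (gen j))
          = (\<Sum>j<n. coord j (fst z) * coord i (gen j)) + (\<Sum>j<n. snd z j * coord i (gen j))"
        by (simp add: ci distrib_right sum.distrib)
      then show ?thesis
        using y that by (simp add: carN coord_expand[OF that x, symmetric])
    qed
    have "fst ?w = fst z"
      using w x s by (intro coord_inject) (auto simp: c1[OF c'])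
    moreover have "snd ?w = snd z"
    proof
      fix i
      show "snd ?w i = snd z i"
        using w y s by (cases "i < n") (auto simp: c2[OF c'] ci carN)
    qed
    ultimately show "is_coords S ?D n b z (\<lambda>i\<in>{..<n}. coord i (fst z) + snd z i)"
      using c by (simp add: is_coords_def prod_eq_iff c_def[symmetric])
  next
    fix c assume "is_coords S ?D n b z c"
    then have c: "c \<in> {..<n} \<rightarrow>\<^sub>E S" and zc: "z = (\<Oplus>\<^bsub>?D\<^esub>j\<in>{..<n}. c j \<odot>\<^bsub>?D\<^esub> b j)"
      by (auto simp: is_coords_def)
    then have c': "c \<in> {..<n} \<rightarrow> S" by (auto simp: PiE_def)
    show "c = (\<lambda>i\<in>{..<n}. coord i (fst z) + snd z i)"
      using c by (intro ext) (auto simp: zc c1[OF c'] c2[OF c'] PiE_def extensional_def)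
  qed
  then have "is_basis S ?D n b"
    using bD by (auto simp: is_basis_def)
  with N show ?thesis by blast
qed

text \<open>Existence for the definite description is \<open>complement_exists\<close>; uniqueness
  holds because any complement and basis yield a dual basis, and \<open>dual_basis_change\<close>
  equates the determinants.\<close>

lemma mod_det_eq:
  assumes f: "endo f"
  shows "mod_det S M f = det (mat n n (\<lambda>(i, j). (if i = j then 1 else 0) - coord i (gen j) + coord i (f (gen j))))"
proof -
  have f': "f \<in> carrier M \<rightarrow> carrier M"
    using f by (simp add: endo_def)
  let ?d = "det (mat n n (\<lambda>(i, j). (if i = j then 1 else 0) - coord i (gen j) + coord i (f (gen j))))"
  have eq: "det (endo_mat S (direct_sum M N) l b (\<lambda>(x, y). (f x, y))) = ?d"
    if "module (ring_on S) N" "is_basis S (direct_sum M N) l b" for N :: "('r, nat \<Rightarrow> 'r) module" and l b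
    unfolding direct_summand_dual_basis(2)[OF that f']
    by (rule dual_basis_change(1)[OF dual_basis_axioms direct_summand_dual_basis(1)[OF that] f])
  obtain N :: "('r, nat \<Rightarrow> 'r) module" and b where "module (ring_on S) N" "is_basis S (direct_sum M N) n b"
    using complement_exists by blast
  then show ?thesis
    unfolding mod_det_def
    by (intro the_equality exI[of _ N] exI[of _ n] exI[of _ b]) (auto simp: eq)
qed

lemma mod_trace_eq:
  assumes f: "endo f"
  shows "mod_trace S M f = (\<Sum>i<n. coord i (f (gen i)))"
proof -
  have f': "f \<in> carrier M \<rightarrow> carrier M"
    using f by (simp add: endo_def)
  have eq: "(\<Sum>i<l. endo_mat S (direct_sum M N) l b (\<lambda>(x, y). (f x, \<zero>\<^bsub>N\<^esub>)) $$ (i, i)) = (\<Sum>i<n. coord i (f (gen i)))"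
    if "module (ring_on S) N" "is_basis S (direct_sum M N) l b" for N :: "('r, nat \<Rightarrow> 'r) module" and l b
    using dual_basis_change(2)[OF dual_basis_axioms direct_summand_dual_basis(1)[OF that] f]
    by (simp add: direct_summand_dual_basis(3)[OF that f'])
  obtain N :: "('r, nat \<Rightarrow> 'r) module" and b where "module (ring_on S) N" "is_basis S (direct_sum M N) n b"
    using complement_exists by blast
  then show ?thesis
    unfolding mod_trace_def
    by (intro the_equality exI[of _ N] exI[of _ n] exI[of _ b]) (auto simp: eq)
qed

lemma mod_rank_eq: "mod_rank S M = (\<Sum>i<n. coord i (gen i))"
  unfolding mod_rank_def by (rule mod_trace_eq[OF endo_id])

end

section \<open>Endomorphisms in coordinates\<close>

context dual_basis
begin

lemma coord_uminus: "i < n \<Longrightarrow> x \<in> carrier M \<Longrightarrow> coord i (\<ominus>\<^bsub>M\<^esub> x) = - coord i x"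
  using coord_add[of i "\<ominus>\<^bsub>M\<^esub> x" x] by (simp add: M.M.l_neg coord_zero eq_neg_iff_add_eq_0)

lemma coord_minus: "i < n \<Longrightarrow> x \<in> carrier M \<Longrightarrow> y \<in> carrier M \<Longrightarrow>
    coord i (x \<ominus>\<^bsub>M\<^esub> y) = coord i x - coord i y"
  by (simp add: a_minus_def coord_add coord_uminus)

lemma endo_closed: "endo f \<Longrightarrow> x \<in> carrier M \<Longrightarrow> f x \<in> carrier M"
  by (auto simp: endo_def)

lemma endo_coord: "endo f \<Longrightarrow> i < n \<Longrightarrow> x \<in> carrier M \<Longrightarrow>
    coord i (f x) = (\<Sum>j<n. coord j x * coord i (f (gen j)))"
  by (auto simp: endo_def)

lemma endo_zero: "endo f \<Longrightarrow> f \<zero>\<^bsub>M\<^esub> = \<zero>\<^bsub>M\<^esub>"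
  by (rule coord_inject) (auto simp: endo_closed zero_closed endo_coord[of f _ "\<zero>\<^bsub>M\<^esub>"] coord_zero)

lemma endo_add:
  assumes "endo f" "endo g"
  shows "endo (\<lambda>x. f x \<oplus>\<^bsub>M\<^esub> g x)"
  unfolding endo_def
proof (intro conjI allI impI ballI)
  show "(\<lambda>x. f x \<oplus>\<^bsub>M\<^esub> g x) \<in> carrier M \<rightarrow> carrier M"
    using assms by (auto simp: endo_closed add_closed)
  fix i x assume "i < n" "x \<in> carrier M"
  then show "coord i (f x \<oplus>\<^bsub>M\<^esub> g x) = (\<Sum>j<n. coord j x * coord i (f (gen j) \<oplus>\<^bsub>M\<^esub> g (gen j)))"
    using assms by (simp add: endo_closed gen_closed coord_add distrib_left sum.distrib
        endo_coord[of f i x, symmetric] endo_coord[of g i x, symmetric])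
qed

lemma endo_minus:
  assumes "endo f" "endo g"
  shows "endo (\<lambda>x. f x \<ominus>\<^bsub>M\<^esub> g x)"
  unfolding endo_def
proof (intro conjI allI impI ballI)
  show "(\<lambda>x. f x \<ominus>\<^bsub>M\<^esub> g x) \<in> carrier M \<rightarrow> carrier M"
    using assms by (auto simp: endo_closed)
  fix i x assume "i < n" "x \<in> carrier M"
  then show "coord i (f x \<ominus>\<^bsub>M\<^esub> g x) = (\<Sum>j<n. coord j x * coord i (f (gen j) \<ominus>\<^bsub>M\<^esub> g (gen j)))"
    using assms by (simp add: endo_closed gen_closed coord_minus right_diff_distrib sum_subtractf
        endo_coord[of f i x, symmetric] endo_coord[of g i x, symmetric])
qed

lemma endo_smult:
  assumes "endo f" "a \<in> S"
  shows "endo (\<lambda>x. a \<odot>\<^bsub>M\<^esub> f x)"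
  unfolding endo_def
proof (intro conjI allI impI ballI)
  show "(\<lambda>x. a \<odot>\<^bsub>M\<^esub> f x) \<in> carrier M \<rightarrow> carrier M"
    using assms by (auto simp: endo_closed smult_closed)
  fix i x assume "i < n" "x \<in> carrier M"
  then show "coord i (a \<odot>\<^bsub>M\<^esub> f x) = (\<Sum>j<n. coord j x * coord i (a \<odot>\<^bsub>M\<^esub> f (gen j)))"
    using assms by (simp add: endo_closed gen_closed coord_smult endo_coord[of f i x]
        sum_distrib_left mult.left_commute)
qed

lemma endoI:
  assumes closed: "\<And>x. x \<in> carrier M \<Longrightarrow> f x \<in> carrier M"
    and add: "\<And>x y. x \<in> carrier M \<Longrightarrow> y \<in> carrier M \<Longrightarrow> f (x \<oplus>\<^bsub>M\<^esub> y) = f x \<oplus>\<^bsub>M\<^esub> f y"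
    and smult: "\<And>a x. a \<in> S \<Longrightarrow> x \<in> carrier M \<Longrightarrow> f (a \<odot>\<^bsub>M\<^esub> x) = a \<odot>\<^bsub>M\<^esub> f x"
  shows "endo f"
  unfolding endo_def
proof (intro conjI allI impI ballI)
  fix i x assume i: "i < n" and x: "x \<in> carrier M"
  have "coord i (f \<zero>\<^bsub>M\<^esub>) = 0"
    using arg_cong[OF add[OF zero_closed zero_closed], of "coord i"] i
    by (simp add: coord_add closed zero_closed)
  then have "coord i (f (\<Oplus>\<^bsub>M\<^esub>j\<in>{..<n}. coord j x \<odot>\<^bsub>M\<^esub> gen j)) = (\<Sum>j<n. coord i (f (coord j x \<odot>\<^bsub>M\<^esub> gen j)))"
    using i x by (intro M.M.additive_finsum)
      (auto simp: add closed coord_add intro!: smult_closed coord_mem gen_closed)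
  then show "coord i (f x) = (\<Sum>j<n. coord j x * coord i (f (gen j)))"
    using i x by (simp add: expand[symmetric] smult coord_mem gen_closed coord_smult closed)
qed (use closed in auto)

end

section \<open>Extension of scalars to polynomials and power series\<close>

text \<open>The functional \<open>c\<close> extended coefficientwise from M to M[u].
  \<open>Abs_poly\<close> is meaningful for sequences of finite support only;
  \<open>coeff_coeff_poly\<close> checks this for coordinate functions.\<close>

definition coeff_poly :: "(nat \<Rightarrow> 'm) \<Rightarrow> ('m \<Rightarrow> 'r::comm_ring_1) \<Rightarrow> 'r poly" where
  "coeff_poly m c = Abs_poly (\<lambda>k. c (m k))"

definition const_seq :: "('r, 'm) module \<Rightarrow> 'm \<Rightarrow> nat \<Rightarrow> 'm" where
  "const_seq M x k = (if k = 0 then x else \<zero>\<^bsub>M\<^esub>)"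

context dual_basis
begin

lemma poly_module_simps:
  "m \<in> carrier (poly_module M) \<longleftrightarrow> range m \<subseteq> carrier M \<and> finite {k. m k \<noteq> \<zero>\<^bsub>M\<^esub>}"
  "\<zero>\<^bsub>poly_module M\<^esub> = (\<lambda>k. \<zero>\<^bsub>M\<^esub>)"
  "m \<oplus>\<^bsub>poly_module M\<^esub> m' = (\<lambda>k. m k \<oplus>\<^bsub>M\<^esub> m' k)"
  "p \<odot>\<^bsub>poly_module M\<^esub> m = (\<lambda>k. \<Oplus>\<^bsub>M\<^esub>i\<in>{..k}. coeff p i \<odot>\<^bsub>M\<^esub> m (k - i))"
  by (simp_all add: poly_module_def)

lemma coeff_coeff_poly:
  assumes "i < n" "m \<in> carrier (poly_module M)"
  shows "coeff (coeff_poly m (coord i)) k = coord i (m k)"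
proof -
  have "finite {k. coord i (m k) \<noteq> 0}"
    using assms by (auto simp: poly_module_simps coord_zero elim!: finite_subset[rotated])
  then show ?thesis
    unfolding coeff_poly_def by (subst Abs_poly_inverse) (auto simp: eventually_cofinite)
qed

lemma const_seq_closed: "x \<in> carrier M \<Longrightarrow> const_seq M x \<in> carrier (poly_module M)"
  by (auto simp: poly_module_simps const_seq_def zero_closed elim!: finite_subset[rotated, of "{0}"])

lemma coeff_poly_const_seq:
  "i < n \<Longrightarrow> x \<in> carrier M \<Longrightarrow> coeff_poly (const_seq M x) (coord i) = [:coord i x:]"
  by (rule poly_eqI) (simp add: coeff_coeff_poly const_seq_closed const_seq_def coord_zero coeff_pCons split: nat.split)

lemma poly_smult_closed:
  assumes p: "\<And>k. coeff p k \<in> S" and m: "m \<in> carrier (poly_module M)"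
  shows "p \<odot>\<^bsub>poly_module M\<^esub> m \<in> carrier (poly_module M)"
proof -
  have mc: "m k \<in> carrier M" for k
    using m by (auto simp: poly_module_simps)
  have zero: "a \<odot>\<^bsub>M\<^esub> \<zero>\<^bsub>M\<^esub> = \<zero>\<^bsub>M\<^esub>" if "a \<in> S" for a
    using M.smult_r_null[of a] that by (simp add: ring_on_simps)
  have zero': "0 \<odot>\<^bsub>M\<^esub> x = \<zero>\<^bsub>M\<^esub>" if "x \<in> carrier M" for x
    using M.smult_l_null[of x] that by (simp add: ring_on_simps)
  obtain N where N: "\<And>k. k > N \<Longrightarrow> m k = \<zero>\<^bsub>M\<^esub>"
    using m finite_nat_set_iff_bounded_le[of "{k. m k \<noteq> \<zero>\<^bsub>M\<^esub>}"]
    by (auto simp: poly_module_simps) (meson leD)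
  have "(\<Oplus>\<^bsub>M\<^esub>i\<in>{..k}. coeff p i \<odot>\<^bsub>M\<^esub> m (k - i)) = \<zero>\<^bsub>M\<^esub>" if k: "k > N + degree p" for k
  proof -
    \<comment> \<open>As k exceeds N + degree p, either i > degree p or k - i > N.\<close>
    have "coeff p i \<odot>\<^bsub>M\<^esub> m (k - i) = \<zero>\<^bsub>M\<^esub>" for i
      using k N[of "k - i"] by (cases "i \<le> degree p") (auto simp: coeff_eq_0 zero zero' p mc)
    then show ?thesis by simp
  qed
  then have "{k. (\<Oplus>\<^bsub>M\<^esub>i\<in>{..k}. coeff p i \<odot>\<^bsub>M\<^esub> m (k - i)) \<noteq> \<zero>\<^bsub>M\<^esub>} \<subseteq> {..N + degree p}"
    by (auto simp: not_less[symmetric])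
  moreover have "(\<Oplus>\<^bsub>M\<^esub>i\<in>{..k}. coeff p i \<odot>\<^bsub>M\<^esub> m (k - i)) \<in> carrier M" for k
    by (rule M.M.finsum_closed) (auto intro: smult_closed p mc)
  ultimately show ?thesis
    by (auto simp: poly_module_simps intro: finite_subset)
qed

text \<open>Base change keeps a dual basis: the generators become constant sequences and their
  coordinates constant polynomials, so each condition reduces to the one for M in every
  degree.\<close>

lemma dual_basis_poly_module:
  "dual_basis {p. \<forall>k. coeff p k \<in> S} (poly_module M) n (\<lambda>i. const_seq M (gen i)) (\<lambda>i m. coeff_poly m (coord i))"
proof
  fix a b assume "a \<in> {p. \<forall>k. coeff p k \<in> S}" "b \<in> {p. \<forall>k. coeff p k \<in> S}"
  then show "a * b \<in> {p. \<forall>k. coeff p k \<in> S}"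
    by (auto simp: coeff_mult intro!: sum_mem mult_mem)
next
  fix x y assume xy: "x \<in> carrier (poly_module M)" "y \<in> carrier (poly_module M)"
  then show add: "x \<oplus>\<^bsub>poly_module M\<^esub> y \<in> carrier (poly_module M)"
    by (auto simp: poly_module_simps add_closed image_subset_iff
        intro: finite_subset[of _ "{k. x k \<noteq> \<zero>\<^bsub>M\<^esub>} \<union> {k. y k \<noteq> \<zero>\<^bsub>M\<^esub>}"])
  show "coeff_poly (x \<oplus>\<^bsub>poly_module M\<^esub> y) (coord i) = coeff_poly x (coord i) + coeff_poly y (coord i)"
    if "i < n" for i
  proof (rule poly_eqI)
    fix k
    show "coeff (coeff_poly (x \<oplus>\<^bsub>poly_module M\<^esub> y) (coord i)) k = coeff (coeff_poly x (coord i) + coeff_poly y (coord i)) k"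
      unfolding coeff_coeff_poly[OF that add] using xy that
      by (auto simp: coeff_coeff_poly poly_module_simps image_subset_iff intro!: coord_add)
  qed
  assume eq: "\<And>i. i < n \<Longrightarrow> coeff_poly x (coord i) = coeff_poly y (coord i)"
  show "x = y"
  proof
    fix k
    have "coord i (x k) = coord i (y k)" if "i < n" for i
      using arg_cong[OF eq[OF that], of "\<lambda>p. coeff p k"] xy that by (simp add: coeff_coeff_poly)
    then show "x k = y k"
      using xy by (intro coord_inject) (auto simp: poly_module_simps)
  qed
next
  fix i p m assume i: "i < n" and p: "p \<in> {p. \<forall>k. coeff p k \<in> S}" and m: "m \<in> carrier (poly_module M)"
  have mc: "m k \<in> carrier M" for k
    using m by (auto simp: poly_module_simps)
  have pm: "p \<odot>\<^bsub>poly_module M\<^esub> m \<in> carrier (poly_module M)"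
    using p m by (intro poly_smult_closed) auto
  show "coeff_poly (p \<odot>\<^bsub>poly_module M\<^esub> m) (coord i) = p * coeff_poly m (coord i)"
  proof (rule poly_eqI)
    fix k
    have "coeff (coeff_poly (p \<odot>\<^bsub>poly_module M\<^esub> m) (coord i)) k
        = coord i (\<Oplus>\<^bsub>M\<^esub>j\<in>{..k}. coeff p j \<odot>\<^bsub>M\<^esub> m (k - j))"
      unfolding coeff_coeff_poly[OF i pm] by (simp add: poly_module_simps)
    also have "\<dots> = (\<Sum>j\<le>k. coeff p j * coord i (m (k - j)))"
      using i p mc by (subst coord_finsum) (auto simp: coord_smult intro!: smult_closed)
    also have "\<dots> = coeff (p * coeff_poly m (coord i)) k"
      using i m by (simp add: coeff_mult coeff_coeff_poly)
    finally show "coeff (coeff_poly (p \<odot>\<^bsub>poly_module M\<^esub> m) (coord i)) k = coeff (p * coeff_poly m (coord i)) k" .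
  qed
next
  fix i m assume i: "i < n" and m: "m \<in> carrier (poly_module M)"
  show "coeff_poly m (coord i) \<in> {p. \<forall>k. coeff p k \<in> S}"
    using i m by (auto simp: coeff_coeff_poly poly_module_simps intro!: coord_mem)
  show "coeff_poly m (coord i) = (\<Sum>j<n. coeff_poly m (coord j) * coeff_poly (const_seq M (gen j)) (coord i))"
  proof (rule poly_eqI)
    fix k
    have mk: "m k \<in> carrier M"
      using m by (auto simp: poly_module_simps)
    have "(\<Sum>j<n. coord j (m k) * coord i (gen j)) = coord i (m k)"
      by (rule coord_expand[OF i mk, symmetric])
    then show "coeff (coeff_poly m (coord i)) k
        = coeff (\<Sum>j<n. coeff_poly m (coord j) * coeff_poly (const_seq M (gen j)) (coord i)) k"
      using i m by (simp add: coeff_poly_const_seq gen_closed coeff_sum coeff_coeff_poly mult.commute)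
  qed
next
  fix i assume i: "i < n"
  have "\<zero>\<^bsub>poly_module M\<^esub> \<in> carrier (poly_module M)"
    by (auto simp: poly_module_simps zero_closed)
  then show "coeff_poly \<zero>\<^bsub>poly_module M\<^esub> (coord i) = 0"
    using i by (intro poly_eqI) (simp add: coeff_coeff_poly, simp add: poly_module_simps coord_zero)
qed (auto simp: zero_mem one_mem add_mem uminus_mem zero_closed const_seq_closed gen_closed
    intro!: poly_smult_closed, auto simp: poly_module_simps zero_closed coeff_1 zero_mem one_mem)

lemma endo_poly_module:
  assumes f: "endo f"
  shows "dual_basis.endo (poly_module M) n (\<lambda>i. const_seq M (gen i)) (\<lambda>i m. coeff_poly m (coord i)) (\<lambda>m. f \<circ> m)"
    and "f \<circ> const_seq M x = const_seq M (f x)"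
proof -
  interpret P: dual_basis "{p. \<forall>k. coeff p k \<in> S}" "poly_module M" n "\<lambda>i. const_seq M (gen i)"
    "\<lambda>i m. coeff_poly m (coord i)" by (rule dual_basis_poly_module)
  show const: "f \<circ> const_seq M x = const_seq M (f x)" for x
    using endo_zero[OF f] by (auto simp: const_seq_def)
  have closed: "f \<circ> m \<in> carrier (poly_module M)" if "m \<in> carrier (poly_module M)" for m
    using that endo_zero[OF f] endo_closed[OF f]
    by (auto simp: poly_module_simps elim!: finite_subset[rotated])
  show "P.endo (\<lambda>m. f \<circ> m)"
    unfolding P.endo_def
  proof (intro conjI allI impI ballI)
    fix i m assume i: "i < n" and m: "m \<in> carrier (poly_module M)"
    show "coeff_poly (f \<circ> m) (coord i) = (\<Sum>j<n. coeff_poly m (coord j) * coeff_poly (f \<circ> const_seq M (gen j)) (coord i))"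
    proof (rule poly_eqI)
      fix k
      have mk: "m k \<in> carrier M"
        using m by (auto simp: poly_module_simps)
      then show "coeff (coeff_poly (f \<circ> m) (coord i)) k
          = coeff (\<Sum>j<n. coeff_poly m (coord j) * coeff_poly (f \<circ> const_seq M (gen j)) (coord i)) k"
        unfolding const using i m endo_coord[OF f i mk] endo_closed[OF f]
        by (simp add: coeff_poly_const_seq gen_closed coeff_sum coeff_coeff_poly closed mult.commute)
    qed
  qed (use closed in auto)
qed

end

text \<open>Base change to S[[u]] for modules of ring elements with the ring operations, which is
  the shape of \<complex>[G] over \<complex>[H]; coordinates are taken coefficientwise.\<close>

lemma dual_basis_fps:
  fixes M :: "('r::comm_ring_1, 'r) module" and M' :: "('r fps, 'r fps) module"
  assumes "dual_basis S M n gen coord"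
    and M: "zero M = 0" "add M = (+)" "smult M = (*)"
    and M': "carrier M' = {Q. \<forall>k. fps_nth Q k \<in> carrier M}" "zero M' = 0" "add M' = (+)" "smult M' = (*)"
  shows "dual_basis {P. \<forall>k. fps_nth P k \<in> S} M' n (\<lambda>i. fps_const (gen i)) (\<lambda>i Q. Abs_fps (\<lambda>k. coord i (fps_nth Q k)))"
proof -
  interpret dual_basis S M n gen coord by fact
  have add: "x + y \<in> carrier M" if "x \<in> carrier M" "y \<in> carrier M" for x y
    using add_closed[OF that] by (simp add: M)
  have zero: "0 \<in> carrier M"
    using zero_closed by (simp add: M)
  have smult: "a * x \<in> carrier M" if "a \<in> S" "x \<in> carrier M" for a x
    using smult_closed[OF that] by (simp add: M)
  have sum: "sum f I \<in> carrier M" if "\<And>i. i \<in> I \<Longrightarrow> f i \<in> carrier M" for f and I :: "nat set"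
    using that by (induction I rule: infinite_finite_induct) (auto intro: zero add)
  have coord_sum: "coord i (sum f I) = (\<Sum>k\<in>I. coord i (f k))"
    if "i < n" "\<And>i. i \<in> I \<Longrightarrow> f i \<in> carrier M" for i f and I :: "nat set"
    using that(2) coord_zero[OF that(1)] coord_add[OF that(1)] sum[of _ f]
    by (induction I rule: infinite_finite_induct) (auto simp: M)
  show ?thesis
  proof
    fix a b assume "a \<in> {P. \<forall>k. fps_nth P k \<in> S}" "b \<in> {P. \<forall>k. fps_nth P k \<in> S}"
    then show "a * b \<in> {P. \<forall>k. fps_nth P k \<in> S}"
      by (auto simp: fps_mult_nth intro!: sum_mem mult_mem)
  next
    fix i P Q assume "i < n" "P \<in> {P. \<forall>k. fps_nth P k \<in> S}" "Q \<in> carrier M'"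
    then show "Abs_fps (\<lambda>k. coord i (fps_nth (P \<odot>\<^bsub>M'\<^esub> Q) k)) = P * Abs_fps (\<lambda>k. coord i (fps_nth Q k))"
      using coord_smult[of i, unfolded M]
      by (intro fps_ext) (auto simp: M' fps_mult_nth coord_sum smult intro!: sum.cong)
  next
    fix P Q assume PQ: "P \<in> carrier M'" "Q \<in> carrier M'"
      and eq: "\<And>i. i < n \<Longrightarrow> Abs_fps (\<lambda>k. coord i (fps_nth P k)) = Abs_fps (\<lambda>k. coord i (fps_nth Q k))"
    show "P = Q"
    proof (rule fps_ext)
      fix k
      have "coord i (fps_nth P k) = coord i (fps_nth Q k)" if "i < n" for i
        using arg_cong[OF eq[OF that], of "\<lambda>P. fps_nth P k"] by simp
      then show "fps_nth P k = fps_nth Q k"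
        using PQ coord_inject[of "fps_nth P k" "fps_nth Q k"] by (simp add: M')
    qed
  next
    fix i Q assume i: "i < n" and Q: "Q \<in> carrier M'"
    have const: "Abs_fps (\<lambda>k. coord i (fps_nth (fps_const (gen j)) k)) = fps_const (coord i (gen j))" for j
      using coord_zero[OF i] by (intro fps_ext) (simp add: M)
    show "Abs_fps (\<lambda>k. coord i (fps_nth Q k))
        = (\<Sum>j<n. Abs_fps (\<lambda>k. coord j (fps_nth Q k)) * Abs_fps (\<lambda>k. coord i (fps_nth (fps_const (gen j)) k)))"
      unfolding const using Q coord_expand[OF i, symmetric]
      by (intro fps_ext) (simp add: M' fps_sum_nth)
  qed (auto simp: M' zero_mem one_mem add_mem uminus_mem mult_mem add zero gen_closed coord_mem fps_mult_nth
      coord_zero[unfolded M] coord_add[unfolded M] fps_eq_iff intro!: sum smult)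
qed

section \<open>Permutation modules of finite abelian groups\<close>

lemma single_sum: "Poly_Mapping.single k (sum f I) = (\<Sum>i\<in>I. Poly_Mapping.single k (f i))"
  by (induction I rule: infinite_finite_induct) (auto simp: single_add)

text \<open>The weight is a function on the whole group type, so one \<open>c\<close> can be
  averaged over both G and H.\<close>

definition avg :: "'g::ab_group_add set \<Rightarrow> ('g \<Rightarrow> complex) \<Rightarrow> 'g \<Rightarrow>\<^sub>0 complex" where
  "avg K c = (\<Sum>g\<in>K. Poly_Mapping.single g (c g / of_nat (card K)))"

lemma lookup_avg:
  "finite K \<Longrightarrow> Poly_Mapping.lookup (avg K c) g = (if g \<in> K then c g / of_nat (card K) else 0)"
  by (simp add: avg_def lookup_sum lookup_single when_def)

lemma avg_add: "avg K (\<lambda>g. c g + d g) = avg K c + avg K d"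
  by (simp add: avg_def add_divide_distrib single_add sum.distrib)

lemma avg_diff: "avg K (\<lambda>g. c g - d g) = avg K c - avg K d"
  by (simp add: avg_def diff_divide_distrib single_diff sum_subtractf)

lemma avg_sum: "avg K (\<lambda>g. \<Sum>i\<in>I. c i g) = (\<Sum>i\<in>I. avg K (c i))"
  unfolding avg_def sum_divide_distrib single_sum by (rule sum.swap)

lemma avg_zero [simp]: "avg K (\<lambda>g. 0) = 0"
  by (simp add: avg_def)

lemma avg_cong: "(\<And>g. g \<in> K \<Longrightarrow> c g = d g) \<Longrightarrow> avg K c = avg K d"
  by (simp add: avg_def)

lemma avg_mem: "finite K \<Longrightarrow> avg K c \<in> grp_alg K"
  by (auto simp: grp_alg_def in_keys_iff lookup_avg split: if_splits)

locale fin_add_group =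
  fixes K :: "'g::ab_group_add set"
  assumes finite_K: "finite K" and zero_K: "0 \<in> K"
    and add_K: "g \<in> K \<Longrightarrow> h \<in> K \<Longrightarrow> g + h \<in> K"
    and uminus_K: "g \<in> K \<Longrightarrow> - g \<in> K"
begin

lemma diff_K: "g \<in> K \<Longrightarrow> h \<in> K \<Longrightarrow> g - h \<in> K"
  using add_K[OF _ uminus_K, of g h] by simp

lemma card_K: "of_nat (card K) \<noteq> (0 :: complex)"
  using finite_K zero_K by auto

lemma sum_shift: "h \<in> K \<Longrightarrow> (\<Sum>k\<in>K. f (k - h)) = sum f K"
  by (rule sum.reindex_bij_witness[of _ "\<lambda>g. g + h" "\<lambda>k. k - h"]) (auto simp: add_K diff_K)

lemma sum_reflect: "h \<in> K \<Longrightarrow> (\<Sum>k\<in>K. f (h - k)) = sum f K"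
  by (rule sum.reindex_bij_witness[of _ "\<lambda>g. h - g" "\<lambda>k. h - k"]) (auto simp: diff_K)

lemma avg_mult:
  "avg K c * avg K d = avg K (\<lambda>k. (\<Sum>h\<in>K. c (k - h) * d h) / of_nat (card K))"
proof -
  let ?N = "of_nat (card K) :: complex"
  have "avg K c * avg K d = (\<Sum>h\<in>K. \<Sum>g\<in>K. Poly_Mapping.single (g + h) (c g / ?N * (d h / ?N)))"
    unfolding avg_def sum_distrib_right sum_distrib_left by (simp add: mult_single)
  also have "\<dots> = (\<Sum>h\<in>K. \<Sum>k\<in>K. Poly_Mapping.single k (c (k - h) / ?N * (d h / ?N)))"
  proof (rule sum.cong[OF refl])
    fix h assume "h \<in> K"
    from sum_shift[OF this, of "\<lambda>g. Poly_Mapping.single (g + h) (c g / ?N * (d h / ?N))"]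
    show "(\<Sum>g\<in>K. Poly_Mapping.single (g + h) (c g / ?N * (d h / ?N)))
        = (\<Sum>k\<in>K. Poly_Mapping.single k (c (k - h) / ?N * (d h / ?N)))"
      by simp
  qed
  also have "\<dots> = avg K (\<lambda>k. (\<Sum>h\<in>K. c (k - h) * d h) / ?N)"
    unfolding avg_def sum_divide_distrib single_sum by (subst sum.swap) simp
  finally show ?thesis .
qed

lemma avg_lookup: "a \<in> grp_alg K \<Longrightarrow> a = avg K (\<lambda>g. of_nat (card K) * Poly_Mapping.lookup a g)"
  using card_K by (intro poly_mapping_eqI) (auto simp: lookup_avg finite_K grp_alg_def in_keys_iff)

text \<open>\<open>lookup a\<close> is the weight of a without the factor 1/|K|, so only the
  normalisation of the average remains on the right.\<close>

lemma mult_avg: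
  "a \<in> grp_alg K \<Longrightarrow> a * avg K d = avg K (\<lambda>k. \<Sum>h\<in>K. Poly_Mapping.lookup a (k - h) * d h)"
  using avg_mult[of "\<lambda>g. of_nat (card K) * Poly_Mapping.lookup a g" d] card_K
  by (simp add: avg_lookup[symmetric] mult.assoc sum_distrib_left[symmetric])

sublocale grp_alg: unital_subring "grp_alg K"
proof
  fix a b assume a: "a \<in> grp_alg K" and b: "b \<in> grp_alg K"
  show "a + b \<in> grp_alg K"
    using a b Poly_Mapping.keys_add[of a b] by (auto simp: grp_alg_def)
  show "- a \<in> grp_alg K"
    using a by (simp add: grp_alg_def)
  show "a * b \<in> grp_alg K"
    using a mult_avg[of a] avg_lookup[OF b] avg_mem[OF finite_K] by metis
qed (auto simp: grp_alg_def zero_K in_keys_iff lookup_one when_def)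

end

locale fin_action = fin_add_group K
  for K :: "'g::ab_group_add set" +
  fixes X :: "'x set" and act :: "'g \<Rightarrow> 'x \<Rightarrow> 'x"
  assumes finite_X: "finite X"
    and act_closed: "g \<in> K \<Longrightarrow> x \<in> X \<Longrightarrow> act g x \<in> X"
    and act_zero: "x \<in> X \<Longrightarrow> act 0 x = x"
    and act_add: "g \<in> K \<Longrightarrow> h \<in> K \<Longrightarrow> x \<in> X \<Longrightarrow> act (g + h) x = act g (act h x)"
begin

lemma act_inverse: "g \<in> K \<Longrightarrow> x \<in> X \<Longrightarrow> act g (act (- g) x) = x" "g \<in> K \<Longrightarrow> x \<in> X \<Longrightarrow> act (- g) (act g x) = x"
  by (simp_all add: act_add[symmetric] uminus_K act_zero)

lemma act_diff: "g \<in> K \<Longrightarrow> h \<in> K \<Longrightarrow> x \<in> X \<Longrightarrow> act (- h) (act g x) = act (g - h) x"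
  by (simp add: act_add[symmetric] uminus_K)

lemma act_inj: "g \<in> K \<Longrightarrow> x \<in> X \<Longrightarrow> y \<in> X \<Longrightarrow> act g x = act g y \<longleftrightarrow> x = y"
  by (metis act_inverse(2))

lemma sum_act: "g \<in> K \<Longrightarrow> (\<Sum>x\<in>X. f (act g x)) = sum f X"
  by (rule sum.reindex_bij_witness[of _ "act (- g)" "act g"]) (auto simp: act_inverse act_closed uminus_K)

definition equivariant :: "('x \<Rightarrow> 'x \<Rightarrow> complex) \<Rightarrow> bool" where
  "equivariant T \<longleftrightarrow> (\<forall>g\<in>K. \<forall>x\<in>X. \<forall>y\<in>X. T (act g x) (act g y) = T x y)"

lemma equivariantD: "equivariant T \<Longrightarrow> g \<in> K \<Longrightarrow> x \<in> X \<Longrightarrow> y \<in> X \<Longrightarrow> T (act g x) (act g y) = T x y"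
  by (simp add: equivariant_def)

definition avg_coord :: "'x \<Rightarrow> ('x \<Rightarrow> complex) \<Rightarrow> 'g \<Rightarrow>\<^sub>0 complex" where
  "avg_coord v f = avg K (\<lambda>g. f (act g v))"

lemma avg_coord_cong: "v \<in> X \<Longrightarrow> (\<And>x. x \<in> X \<Longrightarrow> f x = f' x) \<Longrightarrow> avg_coord v f = avg_coord v f'"
  unfolding avg_coord_def by (rule avg_cong) (simp add: act_closed)

text \<open>Averaging turns a product of complex matrices with equivariant left factor into a
  product over \<complex>[K]. The convolution gives T((k - h) v, z) f(h z); equivariance rewrites
  the first factor as T(k v, h z), and the substitution of z for h z removes h. The sum over h then
  contributes |K|, which cancels one of the two normalising factors.\<close>

lemma avg_coord_mult:
  assumes T: "equivariant T" and v: "v \<in> X"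
  shows "(\<Sum>z\<in>X. avg_coord v (\<lambda>x. T x z) * avg_coord z f) = avg_coord v (\<lambda>x. \<Sum>z\<in>X. T x z * f z)"
proof -
  let ?N = "of_nat (card K) :: complex"
  have "(\<Sum>z\<in>X. avg_coord v (\<lambda>x. T x z) * avg_coord z f)
      = avg K (\<lambda>k. (\<Sum>h\<in>K. \<Sum>z\<in>X. T (act (k - h) v) z * f (act h z)) / ?N)"
    unfolding avg_coord_def avg_mult avg_sum[symmetric] sum_divide_distrib
    by (rule avg_cong) (rule sum.swap)
  also have "\<dots> = avg K (\<lambda>k. (\<Sum>h\<in>K. \<Sum>z\<in>X. T (act k v) z * f z) / ?N)"
  proof (rule avg_cong, rule arg_cong[where f = "\<lambda>s. s / ?N"], rule sum.cong[OF refl])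
    fix k h assume k: "k \<in> K" and h: "h \<in> K"
    have "(\<Sum>z\<in>X. T (act (k - h) v) z * f (act h z)) = (\<Sum>z\<in>X. T (act k v) (act h z) * f (act h z))"
    proof (rule sum.cong[OF refl])
      fix z assume "z \<in> X"
      have "act h (act (k - h) v) = act k v"
        using k h v by (simp add: act_add[symmetric] diff_K)
      then show "T (act (k - h) v) z * f (act h z) = T (act k v) (act h z) * f (act h z)"
        using equivariantD[OF T h act_closed[OF diff_K[OF k h] v] \<open>z \<in> X\<close>] by simp
    qed
    also have "\<dots> = (\<Sum>z\<in>X. T (act k v) z * f z)"
      using sum_act[OF h, of "\<lambda>z. T (act k v) z * f z"] .
    finally show "(\<Sum>z\<in>X. T (act (k - h) v) z * f (act h z)) = (\<Sum>z\<in>X. T (act k v) z * f z)" .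
  qed
  also have "\<dots> = avg_coord v (\<lambda>x. \<Sum>z\<in>X. T x z * f z)"
    unfolding avg_coord_def using card_K by simp
  finally show ?thesis .
qed

text \<open>The identity matrix is equivariant, and its average is P. This yields the expansion
  property of the dual basis.\<close>

lemma avg_coord_delta: "v \<in> X \<Longrightarrow> (\<Sum>z\<in>X. avg_coord v (\<lambda>x. of_bool (x = z)) * avg_coord z f) = avg_coord v f"
  by (subst avg_coord_mult)
    (auto simp: equivariant_def act_inj finite_X sum_of_bool_mult_eq intro!: avg_coord_cong)

lemma lookup_perm_smult:
  assumes a: "a \<in> grp_alg K" and f: "Poly_Mapping.keys f \<subseteq> X" and y: "y \<in> X"
  shows "Poly_Mapping.lookup (a \<odot>\<^bsub>perm_module act X\<^esub> f) y
       = (\<Sum>g\<in>K. Poly_Mapping.lookup a g * Poly_Mapping.lookup f (act (- g) y))"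
proof -
  have aK: "Poly_Mapping.keys a \<subseteq> K"
    using a by (simp add: grp_alg_def)
  have inner: "(\<Sum>x\<in>Poly_Mapping.keys f. Poly_Mapping.lookup a g * Poly_Mapping.lookup f x when act g x = y)
      = Poly_Mapping.lookup a g * Poly_Mapping.lookup f (act (- g) y)" if g: "g \<in> K" for g
  proof -
    have "(\<Sum>x\<in>Poly_Mapping.keys f. Poly_Mapping.lookup a g * Poly_Mapping.lookup f x when act g x = y)
        = (\<Sum>x\<in>X. Poly_Mapping.lookup a g * Poly_Mapping.lookup f x when act g x = y)"
      using f finite_X by (intro sum.mono_neutral_left) (auto simp: in_keys_iff)
    also have "\<dots> = (\<Sum>x\<in>X. if x = act (- g) y then Poly_Mapping.lookup a g * Poly_Mapping.lookup f x else 0)"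
      using g y by (intro sum.cong) (auto simp: when_def act_inverse)
    finally show ?thesis
      using finite_X g y by (simp add: act_closed uminus_K)
  qed
  have "Poly_Mapping.lookup (a \<odot>\<^bsub>perm_module act X\<^esub> f) y
      = (\<Sum>g\<in>Poly_Mapping.keys a. Poly_Mapping.lookup a g * Poly_Mapping.lookup f (act (- g) y))"
    using aK inner by (auto simp: perm_module_def lookup_sum lookup_single intro!: sum.cong)
  also have "\<dots> = (\<Sum>g\<in>K. Poly_Mapping.lookup a g * Poly_Mapping.lookup f (act (- g) y))"
    using aK finite_K by (intro sum.mono_neutral_left) (auto simp: in_keys_iff)
  finally show ?thesis .
qed

lemma perm_smult_closed:
  assumes a: "a \<in> grp_alg K" and f: "Poly_Mapping.keys f \<subseteq> X"
  shows "Poly_Mapping.keys (a \<odot>\<^bsub>perm_module act X\<^esub> f) \<subseteq> X"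
proof
  fix y assume "y \<in> Poly_Mapping.keys (a \<odot>\<^bsub>perm_module act X\<^esub> f)"
  then obtain g x where "g \<in> Poly_Mapping.keys a" "x \<in> Poly_Mapping.keys f" "act g x = y"
    unfolding perm_module_def by (auto dest!: subsetD[OF keys_sum] split: if_splits)
  then show "y \<in> X"
    using a f act_closed by (auto simp: grp_alg_def)
qed

lemma avg_coord_smult:
  assumes a: "a \<in> grp_alg K" and f: "Poly_Mapping.keys f \<subseteq> X" and v: "v \<in> X"
  shows "avg_coord v (Poly_Mapping.lookup (a \<odot>\<^bsub>perm_module act X\<^esub> f)) = a * avg_coord v (Poly_Mapping.lookup f)"
  unfolding avg_coord_def mult_avg[OF a]
proof (rule avg_cong)
  fix k assume k: "k \<in> K"
  have "Poly_Mapping.lookup (a \<odot>\<^bsub>perm_module act X\<^esub> f) (act k v)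
      = (\<Sum>g\<in>K. Poly_Mapping.lookup a g * Poly_Mapping.lookup f (act (k - g) v))"
    using k v by (simp add: lookup_perm_smult[OF a f] act_closed act_diff)
  also have "\<dots> = (\<Sum>h\<in>K. Poly_Mapping.lookup a (k - h) * Poly_Mapping.lookup f (act h v))"
    using sum_reflect[OF k, of "\<lambda>g. Poly_Mapping.lookup a g * Poly_Mapping.lookup f (act (k - g) v)"] by simp
  finally show "Poly_Mapping.lookup (a \<odot>\<^bsub>perm_module act X\<^esub> f) (act k v)
      = (\<Sum>h\<in>K. Poly_Mapping.lookup a (k - h) * Poly_Mapping.lookup f (act h v))" .
qed

text \<open>The coefficient at 0 of \<open>avg_coord v f\<close> is f(v)/|K|, so the coordinates at
  all v determine f on X.\<close>

lemma avg_coord_eqD: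
  assumes "avg_coord v f = avg_coord v f'" "v \<in> X"
  shows "f v = f' v"
  using arg_cong[OF assms(1), of "\<lambda>a. Poly_Mapping.lookup a 0"] card_K assms(2) zero_K
  by (simp add: avg_coord_def lookup_avg finite_K act_zero)

lemma avg_coord_add: "avg_coord v (\<lambda>x. f x + f' x) = avg_coord v f + avg_coord v f'"
  by (simp add: avg_coord_def avg_add)

lemma lookup_single_one: "Poly_Mapping.lookup (Poly_Mapping.single z (1 :: complex)) = (\<lambda>x. of_bool (x = z))"
  by (auto simp: lookup_single when_def)

context
  fixes e :: "nat \<Rightarrow> 'x"
  assumes e: "bij_betw e {..<card X} X"
begin

lemma enum_mem: "i < card X \<Longrightarrow> e i \<in> X"
  using bij_betwE[OF e] by auto

lemma sum_enum: "(\<Sum>i<card X. f (e i)) = sum f X"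
  by (rule sum.reindex_bij_betw[OF e])

lemma enum_surj: "x \<in> X \<Longrightarrow> \<exists>i<card X. x = e i"
  using bij_betw_imp_surj_on[OF e] by auto

lemma dual_basis_perm_module:
  "dual_basis (grp_alg K) (perm_module act X) (card X) (\<lambda>i. Poly_Mapping.single (e i) 1)
     (\<lambda>i f. avg_coord (e i) (Poly_Mapping.lookup f))"
proof
  let ?M = "perm_module act X"
  have car: "f \<in> carrier ?M \<longleftrightarrow> Poly_Mapping.keys f \<subseteq> X" for f
    by (simp add: perm_module_def)
  have add: "f \<oplus>\<^bsub>?M\<^esub> f' = f + f'" for f f'
    by (simp add: perm_module_def)
  show "\<zero>\<^bsub>?M\<^esub> \<in> carrier ?M"
    by (simp add: perm_module_def)
  show "f \<oplus>\<^bsub>?M\<^esub> f' \<in> carrier ?M" if "f \<in> carrier ?M" "f' \<in> carrier ?M" for f f'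
    using that Poly_Mapping.keys_add[of f f'] by (auto simp: car add)
  show "a \<odot>\<^bsub>?M\<^esub> f \<in> carrier ?M" if "a \<in> grp_alg K" "f \<in> carrier ?M" for a f
    using that perm_smult_closed by (simp add: car)
  show "avg_coord (e i) (Poly_Mapping.lookup (a \<odot>\<^bsub>?M\<^esub> f)) = a * avg_coord (e i) (Poly_Mapping.lookup f)"
    if "i < card X" "a \<in> grp_alg K" "f \<in> carrier ?M" for i a f
    using that by (simp add: car avg_coord_smult enum_mem)
  show "f = f'" if ff': "f \<in> carrier ?M" "f' \<in> carrier ?M"
    and eq: "\<And>i. i < card X \<Longrightarrow> avg_coord (e i) (Poly_Mapping.lookup f) = avg_coord (e i) (Poly_Mapping.lookup f')" for f f'
  proof (rule poly_mapping_eqI)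
    fix x
    show "Poly_Mapping.lookup f x = Poly_Mapping.lookup f' x"
    proof (cases "x \<in> X")
      case True
      then show ?thesis using enum_surj[OF True] eq avg_coord_eqD by blast
    next
      case False
      then show ?thesis using ff' by (metis car subsetD not_in_keys_iff_lookup_eq_zero)
    qed
  qed
  show "avg_coord (e i) (Poly_Mapping.lookup f) = (\<Sum>j<card X. avg_coord (e j) (Poly_Mapping.lookup f) *
      avg_coord (e i) (Poly_Mapping.lookup (Poly_Mapping.single (e j) 1)))" if "i < card X" for i f
    unfolding lookup_single_one
      sum_enum[of "\<lambda>z. avg_coord z (Poly_Mapping.lookup f) * avg_coord (e i) (\<lambda>x. of_bool (x = z))"]
    using avg_coord_delta[OF enum_mem[OF that], of "Poly_Mapping.lookup f"] by (simp add: mult.commute)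
qed (auto simp: perm_module_def enum_mem plus_poly_mapping.rep_eq avg_coord_def avg_add avg_mem finite_K)

text \<open>An operator given by an equivariant complex matrix has, over \<complex>[K], the average
  of that matrix; linearity becomes an instance of \<open>avg_coord_mult\<close>.\<close>

lemma endo_perm_module:
  assumes T: "equivariant T"
    and closed: "\<And>f. Poly_Mapping.keys f \<subseteq> X \<Longrightarrow> Poly_Mapping.keys (F f) \<subseteq> X"
    and lookup: "\<And>f x. Poly_Mapping.keys f \<subseteq> X \<Longrightarrow> x \<in> X \<Longrightarrow>
      Poly_Mapping.lookup (F f) x = (\<Sum>z\<in>X. T x z * Poly_Mapping.lookup f z)"
  shows "dual_basis.endo (perm_module act X) (card X) (\<lambda>i. Poly_Mapping.single (e i) 1)
     (\<lambda>i f. avg_coord (e i) (Poly_Mapping.lookup f)) F"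
    and "i < card X \<Longrightarrow> j < card X \<Longrightarrow>
      avg_coord (e i) (Poly_Mapping.lookup (F (Poly_Mapping.single (e j) 1))) = avg_coord (e i) (\<lambda>x. T x (e j))"
proof -
  show gen: "avg_coord (e i) (Poly_Mapping.lookup (F (Poly_Mapping.single (e j) 1))) = avg_coord (e i) (\<lambda>x. T x (e j))"
    if "i < card X" "j < card X" for i j
    using that enum_mem by (intro avg_coord_cong) (auto simp: lookup lookup_single_one finite_X mult.commute sum_of_bool_mult_eq)
  interpret dual_basis "grp_alg K" "perm_module act X" "card X" "\<lambda>i. Poly_Mapping.single (e i) 1"
    "\<lambda>i f. avg_coord (e i) (Poly_Mapping.lookup f)" by (rule dual_basis_perm_module)
  show "endo F"
    unfolding endo_def
  proof (intro conjI allI impI ballI)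
    fix i f assume i: "i < card X" and f: "f \<in> carrier (perm_module act X)"
    have "avg_coord (e i) (Poly_Mapping.lookup (F f)) = avg_coord (e i) (\<lambda>x. \<Sum>z\<in>X. T x z * Poly_Mapping.lookup f z)"
      using i f enum_mem by (intro avg_coord_cong) (auto simp: lookup perm_module_def)
    also have "\<dots> = (\<Sum>z\<in>X. avg_coord (e i) (\<lambda>x. T x z) * avg_coord z (Poly_Mapping.lookup f))"
      using avg_coord_mult[OF T enum_mem[OF i]] by simp
    also have "\<dots> = (\<Sum>j<card X. avg_coord (e j) (Poly_Mapping.lookup f) *
        avg_coord (e i) (Poly_Mapping.lookup (F (Poly_Mapping.single (e j) 1))))"
      unfolding sum_enum[symmetric] by (intro sum.cong refl) (simp add: gen i mult.commute)
    finally show "avg_coord (e i) (Poly_Mapping.lookup (F f)) = (\<Sum>j<card X. avg_coord (e j) (Poly_Mapping.lookup f) *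
        avg_coord (e i) (Poly_Mapping.lookup (F (Poly_Mapping.single (e j) 1))))" .
  qed (use closed in \<open>auto simp: perm_module_def\<close>)
qed

end

lemma enumeration: "\<exists>e. bij_betw e {..<card X} X"
  using ex_bij_betw_nat_finite[OF finite_X] by (simp add: atLeast0LessThan)

end

section \<open>Ranks\<close>

context fin_action
begin

text \<open>The trace of the averaged identity matrix; its weight is the permutation character of
  X.\<close>

lemma mod_rank_perm_module:
  "mod_rank (grp_alg K) (perm_module act X) = avg K (\<lambda>g. \<Sum>z\<in>X. of_bool (act g z = z))"
proof -
  obtain e where e: "bij_betw e {..<card X} X"
    using enumeration by blast
  show ?thesis
    unfolding dual_basis.mod_rank_eq[OF dual_basis_perm_module[OF e]] lookup_single_one
      sum_enum[OF e, of "\<lambda>z. avg_coord z (\<lambda>x. of_bool (x = z))"]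
    by (simp add: avg_coord_def avg_sum)
qed

end

section \<open>The quotient of a permutation module by the relations of an involution\<close>

locale fin_action_involution = fin_action K X act
  for K :: "'g::ab_group_add set" and X :: "'x set" and act +
  fixes rv :: "'x \<Rightarrow> 'x"
  assumes rv_closed: "x \<in> X \<Longrightarrow> rv x \<in> X"
    and rv_rv: "x \<in> X \<Longrightarrow> rv (rv x) = x"
    and act_rv: "g \<in> K \<Longrightarrow> x \<in> X \<Longrightarrow> act g (rv x) = rv (act g x)"
begin

abbreviation "PM \<equiv> perm_module act X"

definition rels :: "('x \<Rightarrow>\<^sub>0 complex) set" where
  "rels = {\<Sum>e\<in>X. Poly_Mapping.single e (c e) + Poly_Mapping.single (rv e) (c e) | c. True}"

text \<open>Up to a factor 2 the alternating part of f. For f supported on X it is a complete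
  invariant modulo the relations, by \<open>rels_iff\<close>.\<close>

definition alt :: "('x \<Rightarrow>\<^sub>0 complex) \<Rightarrow> 'x \<Rightarrow> complex" where
  "alt f x = Poly_Mapping.lookup f x - Poly_Mapping.lookup f (rv x)"

lemma alt_add: "alt (f + f') x = alt f x + alt f' x"
  by (simp add: alt_def plus_poly_mapping.rep_eq)

lemma alt_diff: "alt (f - f') x = alt f x - alt f' x"
  by (simp add: alt_def minus_poly_mapping.rep_eq)

lemma lookup_eq_0: "Poly_Mapping.keys f \<subseteq> X \<Longrightarrow> x \<notin> X \<Longrightarrow> Poly_Mapping.lookup f x = 0"
  by (metis subsetD not_in_keys_iff_lookup_eq_zero)

lemma rels_iff: "f \<in> rels \<longleftrightarrow> Poly_Mapping.keys f \<subseteq> X \<and> (\<forall>x\<in>X. alt f x = 0)"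
proof
  have look: "Poly_Mapping.lookup (\<Sum>e\<in>X. Poly_Mapping.single e (c e) + Poly_Mapping.single (rv e) (c e)) x
      = (if x \<in> X then c x + c (rv x) else 0)" for c x
  proof -
    have "(\<Sum>e\<in>X. (c e when e = x) + (c e when rv e = x)) = (if x \<in> X then c x + c (rv x) else 0)"
    proof (cases "x \<in> X")
      case True
      have "(\<Sum>e\<in>X. c e when rv e = x) = (\<Sum>e\<in>X. if e = rv x then c e else 0)"
        using True by (intro sum.cong) (auto simp: when_def rv_rv)
      with True show ?thesis
        using finite_X by (simp add: sum.distrib rv_closed when_def)
    next
      case False
      then show ?thesis
        using rv_closed by (auto simp: when_def intro!: sum.neutral)
    qed
    then show ?thesis
      by (simp add: lookup_sum lookup_single plus_poly_mapping.rep_eq)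
  qed
  show "Poly_Mapping.keys f \<subseteq> X \<and> (\<forall>x\<in>X. alt f x = 0)" if f': "f \<in> rels"
  proof -
    obtain c where f: "f = (\<Sum>e\<in>X. Poly_Mapping.single e (c e) + Poly_Mapping.single (rv e) (c e))"
      using f' by (auto simp: rels_def)
    have "Poly_Mapping.lookup f x = (if x \<in> X then c x + c (rv x) else 0)" for x
      unfolding f by (rule look)
    then show ?thesis
      by (auto simp: in_keys_iff alt_def rv_closed rv_rv split: if_splits)
  qed
  show "f \<in> rels" if f: "Poly_Mapping.keys f \<subseteq> X \<and> (\<forall>x\<in>X. alt f x = 0)"
    unfolding rels_def
  \<comment> \<open>The vanishing of \<open>alt f\<close> means f is symmetric under
    \<open>rv\<close>. The weights are halved because the sum reaches each x once from x and once
    from \<open>rv x\<close>.\<close>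
  proof (intro CollectI exI conjI TrueI poly_mapping_eqI)
    fix x
    show "Poly_Mapping.lookup f x = Poly_Mapping.lookup (\<Sum>e\<in>X. Poly_Mapping.single e (Poly_Mapping.lookup f e / 2)
        + Poly_Mapping.single (rv e) (Poly_Mapping.lookup f e / 2)) x"
      unfolding look using f by (auto simp: alt_def lookup_eq_0)
  qed
qed

text \<open>The coset of f, described by the invariant \<open>alt\<close> instead of as a translate
  of the relations, so that comparing cosets means comparing functions on X.\<close>

definition cls :: "('x \<Rightarrow>\<^sub>0 complex) \<Rightarrow> ('x \<Rightarrow>\<^sub>0 complex) set" where
  "cls f = {f'. Poly_Mapping.keys f' \<subseteq> X \<and> (\<forall>x\<in>X. alt f' x = alt f x)}"

lemma cls_eq_iff:
  "Poly_Mapping.keys f \<subseteq> X \<Longrightarrow> cls f = cls f' \<longleftrightarrow> (\<forall>x\<in>X. alt f x = alt f' x)"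
  by (auto simp: cls_def set_eq_iff)

lemma keys_diff_subset: "Poly_Mapping.keys f \<subseteq> X \<Longrightarrow> Poly_Mapping.keys f' \<subseteq> X \<Longrightarrow> Poly_Mapping.keys (f - f') \<subseteq> X"
  by (meson keys_diff le_sup_iff order_trans)

lemma keys_add_subset: "Poly_Mapping.keys f \<subseteq> X \<Longrightarrow> Poly_Mapping.keys f' \<subseteq> X \<Longrightarrow> Poly_Mapping.keys (f + f') \<subseteq> X"
  by (meson Poly_Mapping.keys_add le_sup_iff order_trans)

lemma coset_eq_cls:
  assumes f: "Poly_Mapping.keys f \<subseteq> X"
  shows "rels +>\<^bsub>PM\<^esub> f = cls f"
proof -
  have "rels +>\<^bsub>PM\<^esub> f = {w + f | w. w \<in> rels}"
    by (auto simp: a_r_coset_def r_coset_def perm_module_def)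
  also have "\<dots> = cls f"
  proof (intro equalityI subsetI)
    fix x assume "x \<in> {w + f |w. w \<in> rels}"
    then show "x \<in> cls f"
      using f by (auto simp: cls_def rels_iff alt_add dest!: subsetD[OF Poly_Mapping.keys_add])
  next
    fix x assume "x \<in> cls f"
    then have "x = (x - f) + f \<and> x - f \<in> rels"
      using f by (auto simp: cls_def rels_iff alt_diff keys_diff_subset)
    then show "x \<in> {w + f |w. w \<in> rels}" by blast
  qed
  finally show ?thesis .
qed

abbreviation "QM \<equiv> quot_module PM rels"

lemma carrier_QM: "carrier QM = cls ` {f. Poly_Mapping.keys f \<subseteq> X}"
  using coset_eq_cls
  by (auto simp: quot_module_def A_RCOSETS_def RCOSETS_def a_r_coset_def perm_module_def)

lemma zero_QM: "\<zero>\<^bsub>QM\<^esub> = cls 0"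
  by (auto simp: quot_module_def rels_iff cls_def alt_def)

lemma add_QM:
  assumes "Poly_Mapping.keys f \<subseteq> X" "Poly_Mapping.keys f' \<subseteq> X"
  shows "cls f \<oplus>\<^bsub>QM\<^esub> cls f' = cls (f + f')"
proof -
  have "cls f \<oplus>\<^bsub>QM\<^esub> cls f' = {h + k | h k. h \<in> cls f \<and> k \<in> cls f'}"
    by (auto simp: quot_module_def set_add_def set_mult_def perm_module_def)
  also have "\<dots> = cls (f + f')"
  proof (intro equalityI subsetI)
    fix x assume "x \<in> {h + k | h k. h \<in> cls f \<and> k \<in> cls f'}"
    then show "x \<in> cls (f + f')"
      by (auto simp: cls_def alt_add dest!: subsetD[OF Poly_Mapping.keys_add])
  next
    fix x assume "x \<in> cls (f + f')"
    then have "x = f + (x - f) \<and> f \<in> cls f \<and> x - f \<in> cls f'"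
      using assms by (auto simp: cls_def alt_add alt_diff keys_diff_subset)
    then show "x \<in> {h + k | h k. h \<in> cls f \<and> k \<in> cls f'}" by blast
  qed
  finally show ?thesis .
qed

lemma alt_smult:
  assumes a: "a \<in> grp_alg K" and f: "Poly_Mapping.keys f \<subseteq> X" and x: "x \<in> X"
  shows "alt (a \<odot>\<^bsub>PM\<^esub> f) x = (\<Sum>g\<in>K. Poly_Mapping.lookup a g * alt f (act (- g) x))"
  using x unfolding alt_def lookup_perm_smult[OF a f x] lookup_perm_smult[OF a f rv_closed[OF x]]
  by (simp add: act_rv uminus_K sum_subtractf[symmetric] right_diff_distrib)

text \<open>In \<open>quot_module\<close> the scalar multiple is a union over all representatives of
  a class. By \<open>alt_smult\<close> they all give the same coset, so the union is that
  coset.\<close>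

lemma smult_QM:
  assumes a: "a \<in> grp_alg K" and f: "Poly_Mapping.keys f \<subseteq> X"
  shows "a \<odot>\<^bsub>QM\<^esub> cls f = cls (a \<odot>\<^bsub>PM\<^esub> f)"
proof -
  have "rels +>\<^bsub>PM\<^esub> (a \<odot>\<^bsub>PM\<^esub> x) = cls (a \<odot>\<^bsub>PM\<^esub> f)" if "x \<in> cls f" for x
  proof -
    have x: "Poly_Mapping.keys x \<subseteq> X" and alt: "\<And>y. y \<in> X \<Longrightarrow> alt x y = alt f y"
      using that by (auto simp: cls_def)
    show ?thesis
      using a f x alt
      by (subst coset_eq_cls) (auto simp: perm_smult_closed[OF a x] cls_eq_iff alt_smult act_closed uminus_K)
  qed
  moreover have "f \<in> cls f"
    using f by (simp add: cls_def)
  ultimately show ?thesis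
    by (auto simp: quot_module_def)
qed

text \<open>The choice of a representative is harmless, since \<open>alt\<close> is constant on a
  class.\<close>

definition cls_coord :: "'x \<Rightarrow> ('x \<Rightarrow>\<^sub>0 complex) set \<Rightarrow> 'g \<Rightarrow>\<^sub>0 complex" where
  "cls_coord v A = avg_coord v (alt (SOME f. f \<in> A))"

lemma cls_coord:
  assumes "v \<in> X" "Poly_Mapping.keys f \<subseteq> X"
  shows "cls_coord v (cls f) = avg_coord v (alt f)"
proof -
  have "f \<in> cls f"
    using assms by (simp add: cls_def)
  then have "(SOME f'. f' \<in> cls f) \<in> cls f"
    by (rule someI)
  then show ?thesis
    unfolding cls_coord_def using assms by (intro avg_coord_cong) (auto simp: cls_def)
qed

lemma avg_coord_alt:
  assumes "v \<in> X"
  shows "avg_coord v (alt f) = avg_coord v (Poly_Mapping.lookup f) - avg_coord (rv v) (Poly_Mapping.lookup f)"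
  unfolding avg_coord_def alt_def avg_diff[symmetric] using assms by (intro avg_cong) (simp add: act_rv)

text \<open>The projector onto alternating functions. It plays the role of the identity matrix, as
  \<open>alt\<close> identifies the quotient with the space of these functions.\<close>

definition proj :: "'x \<Rightarrow> 'x \<Rightarrow> complex" where
  "proj x z = (of_bool (x = z) - of_bool (rv x = z)) / 2"

lemma equivariant_proj: "equivariant proj"
  by (auto simp: equivariant_def proj_def act_rv[symmetric] act_inj rv_closed)

lemma sum_proj: "x \<in> X \<Longrightarrow> (\<Sum>z\<in>X. proj x z * alt f z) = alt f x"
  using finite_X rv_closed[of x]
  by (simp add: proj_def diff_divide_distrib left_diff_distrib sum_subtractf sum_divide_distrib[symmetric]
      sum_of_bool_mult_eq) (simp add: alt_def rv_rv field_simps)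

text \<open>The quotient inherits the coordinates of \<complex>X through \<open>alt\<close>. All x
  in X serve as generators, so each class is reached from x and, with opposite sign, from
  \<open>rv x\<close>; the weight 1/2 compensates for this. The matrix P is the average of
  \<open>proj\<close>.\<close>

lemma dual_basis_QM:
  assumes e: "bij_betw e {..<card X} X"
  shows "dual_basis (grp_alg K) QM (card X) (\<lambda>i. cls (Poly_Mapping.single (e i) (1 / 2))) (\<lambda>i. cls_coord (e i))"
    and "i < card X \<Longrightarrow> j < card X \<Longrightarrow>
      cls_coord (e i) (cls (Poly_Mapping.single (e j) (1 / 2))) = avg_coord (e i) (\<lambda>x. proj x (e j))"
proof -
  note enum_mem = enum_mem[OF e]
  have gen: "Poly_Mapping.keys (Poly_Mapping.single (e j) (1 / 2 :: complex)) \<subseteq> X" if "j < card X" for j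
    using enum_mem[OF that] by simp
  show coord_gen: "cls_coord (e i) (cls (Poly_Mapping.single (e j) (1 / 2))) = avg_coord (e i) (\<lambda>x. proj x (e j))"
    if "i < card X" "j < card X" for i j
    using that gen[OF that(2)] enum_mem unfolding cls_coord[OF enum_mem[OF that(1)] gen[OF that(2)]]
    by (intro avg_coord_cong) (auto simp: alt_def proj_def lookup_single when_def)
  show "dual_basis (grp_alg K) QM (card X) (\<lambda>i. cls (Poly_Mapping.single (e i) (1 / 2))) (\<lambda>i. cls_coord (e i))"
  proof
    show "\<zero>\<^bsub>QM\<^esub> \<in> carrier QM"
      by (auto simp: zero_QM carrier_QM)
    show "x \<oplus>\<^bsub>QM\<^esub> y \<in> carrier QM" if "x \<in> carrier QM" "y \<in> carrier QM" for x y
      using that by (auto simp: carrier_QM add_QM keys_add_subset)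
    show "a \<odot>\<^bsub>QM\<^esub> x \<in> carrier QM" if "a \<in> grp_alg K" "x \<in> carrier QM" for a x
      using that perm_smult_closed by (auto simp: carrier_QM smult_QM)
    show "cls (Poly_Mapping.single (e i) (1 / 2)) \<in> carrier QM" if "i < card X" for i
      using gen[OF that] by (auto simp: carrier_QM)
    show "cls_coord (e i) x \<in> grp_alg K" for i x
      by (simp add: cls_coord_def avg_coord_def avg_mem finite_K)
    show "cls_coord (e i) \<zero>\<^bsub>QM\<^esub> = 0" if "i < card X" for i
      using enum_mem[OF that] by (simp add: zero_QM cls_coord) (simp add: alt_def avg_coord_def)
    show "cls_coord (e i) (x \<oplus>\<^bsub>QM\<^esub> y) = cls_coord (e i) x + cls_coord (e i) y"
      if "i < card X" "x \<in> carrier QM" "y \<in> carrier QM" for i x y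
      using that enum_mem by (auto simp: carrier_QM add_QM cls_coord keys_add_subset avg_coord_def alt_add avg_add)
    show "cls_coord (e i) (a \<odot>\<^bsub>QM\<^esub> x) = a * cls_coord (e i) x"
      if "i < card X" "a \<in> grp_alg K" "x \<in> carrier QM" for i a x
      using that enum_mem by (auto simp: carrier_QM smult_QM cls_coord perm_smult_closed avg_coord_alt
          avg_coord_smult rv_closed right_diff_distrib)
    show "x = y" if xy: "x \<in> carrier QM" "y \<in> carrier QM"
      and eq: "\<And>i. i < card X \<Longrightarrow> cls_coord (e i) x = cls_coord (e i) y" for x y
    proof -
      obtain f f' where f: "x = cls f" "y = cls f'" "Poly_Mapping.keys f \<subseteq> X" "Poly_Mapping.keys f' \<subseteq> X"
        using xy by (auto simp: carrier_QM)
      have "alt f z = alt f' z" if z: "z \<in> X" for z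
      proof -
        obtain i where i: "i < card X" "z = e i"
          using enum_surj[OF e z] by blast
        then have "avg_coord z (alt f) = avg_coord z (alt f')"
          using eq[OF i(1)] f z by (simp add: cls_coord)
        then show ?thesis
          using z by (rule avg_coord_eqD)
      qed
      then show ?thesis
        by (simp add: f cls_eq_iff)
    qed
    show "cls_coord (e i) x = (\<Sum>j<card X. cls_coord (e j) x * cls_coord (e i) (cls (Poly_Mapping.single (e j) (1 / 2))))"
      if i: "i < card X" and x: "x \<in> carrier QM" for i x
    proof -
      obtain f where f: "x = cls f" "Poly_Mapping.keys f \<subseteq> X"
        using x by (auto simp: carrier_QM)
      have "(\<Sum>j<card X. cls_coord (e j) x * cls_coord (e i) (cls (Poly_Mapping.single (e j) (1 / 2))))
          = (\<Sum>j<card X. avg_coord (e i) (\<lambda>x. proj x (e j)) * avg_coord (e j) (alt f))"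
        using f enum_mem by (intro sum.cong refl, subst coord_gen[OF i]) (auto simp: cls_coord mult.commute)
      also have "\<dots> = (\<Sum>z\<in>X. avg_coord (e i) (\<lambda>x. proj x z) * avg_coord z (alt f))"
        by (rule sum_enum[OF e])
      also have "\<dots> = avg_coord (e i) (\<lambda>x. \<Sum>z\<in>X. proj x z * alt f z)"
        by (rule avg_coord_mult[OF equivariant_proj enum_mem[OF i]])
      also have "\<dots> = avg_coord (e i) (alt f)"
        using enum_mem[OF i] by (intro avg_coord_cong) (simp_all add: sum_proj)
      finally show ?thesis
        using i f enum_mem by (simp add: cls_coord)
    qed
  qed
qed

lemma mod_rank_QM: "mod_rank (grp_alg K) QM = avg K (\<lambda>g. \<Sum>z\<in>X. proj (act g z) z)"
proof -
  obtain e where e: "bij_betw e {..<card X} X"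
    using enumeration by blast
  have "mod_rank (grp_alg K) QM = (\<Sum>i<card X. avg_coord (e i) (\<lambda>x. proj x (e i)))"
    unfolding dual_basis.mod_rank_eq[OF dual_basis_QM(1)[OF e]] by (simp add: dual_basis_QM(2)[OF e])
  also have "\<dots> = (\<Sum>z\<in>X. avg_coord z (\<lambda>x. proj x z))"
    by (rule sum_enum[OF e])
  finally show ?thesis
    by (simp add: avg_coord_def avg_sum)
qed

end

section \<open>Integer factors in the group algebra\<close>

lemma of_nat_single: "of_nat n = Poly_Mapping.single (0 :: 'g::ab_group_add) (of_nat n :: complex)"
  by (induction n) (simp_all add: single_add single_one[symmetric] del: single_one)

text \<open>Provides division by positive integers in a ring that is not a field in general.\<close>

lemma single_inverse_Suc: "Poly_Mapping.single (0 :: 'g::ab_group_add) (1 / of_nat (Suc n) :: complex) * of_nat (Suc n) = 1"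
  unfolding of_nat_single mult_single by (simp add: single_one del: of_nat_Suc)

lemma avg_mult_single: "avg K c * Poly_Mapping.single 0 d = avg K (\<lambda>g. c g * d)"
  by (simp add: avg_def sum_distrib_right mult_single)

lemma of_nat_mult_avg: "of_nat n * avg K c = avg K (\<lambda>g. of_nat n * c g)"
  using avg_mult_single[of K c "of_nat n"] by (simp add: of_nat_single[symmetric] mult.commute)

lemma avg_uminus: "avg K (\<lambda>g. - c g) = - avg K c"
  using avg_diff[of K "\<lambda>_. 0" c] by simp

section \<open>Power series determined by their logarithmic derivative\<close>

text \<open>Stated as x' = x L instead of x'/x = L, so that it involves no inverse of x; the
  constant term 1 singles out one solution.\<close>

definition log_deriv :: "'g::ab_group_add set \<Rightarrow> (nat \<Rightarrow> 'g \<Rightarrow> complex) \<Rightarrow> ('g \<Rightarrow>\<^sub>0 complex) fps \<Rightarrow> bool" where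
  "log_deriv K c x \<longleftrightarrow> fps_nth x 0 = 1 \<and> fps_deriv x = x * Abs_fps (\<lambda>n. avg K (c n))"

text \<open>The degree n part of x' = x L, solved for the coefficient n + 1: the right side involves
  earlier coefficients only.\<close>

lemma log_deriv_Suc:
  assumes "log_deriv K c x"
  shows "fps_nth x (Suc n) = Poly_Mapping.single 0 (1 / of_nat (Suc n)) * (\<Sum>i=0..n. fps_nth x i * avg K (c (n - i)))"
proof -
  have "fps_nth (fps_deriv x) n = fps_nth (x * Abs_fps (\<lambda>n. avg K (c n))) n"
    using assms unfolding log_deriv_def by (elim conjE) (simp only:)
  then have eq: "of_nat (Suc n) * fps_nth x (Suc n) = (\<Sum>i=0..n. fps_nth x i * avg K (c (n - i)))"
    by (simp add: fps_mult_nth)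
  show ?thesis
    unfolding eq[symmetric] mult.assoc[symmetric] single_inverse_Suc by simp
qed

lemma log_deriv_unique:
  assumes "log_deriv K c x" "log_deriv K c y"
  shows "x = y"
proof (rule fps_ext)
  fix n
  show "fps_nth x n = fps_nth y n"
  proof (induction n rule: less_induct)
    case (less n)
    then show ?case
      using assms by (cases n) (auto simp: log_deriv_Suc[OF assms(1)] log_deriv_Suc[OF assms(2)] less_Suc_eq_le
          log_deriv_def intro!: sum.cong arg_cong2[where f = "(*)"])
  qed
qed

lemma log_deriv_mult:
  assumes "log_deriv K c x" "log_deriv K d y"
  shows "log_deriv K (\<lambda>n g. c n g + d n g) (x * y)"
proof -
  have "Abs_fps (\<lambda>n. avg K (\<lambda>g. c n g + d n g)) = Abs_fps (\<lambda>n. avg K (c n)) + Abs_fps (\<lambda>n. avg K (d n))"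
    by (simp add: fps_eq_iff avg_add)
  then show ?thesis
    using assms by (auto simp: log_deriv_def algebra_simps)
qed

text \<open>Differentiating x y = 1 gives x (y' + y L) = 0, and multiplying by y cancels x.\<close>

lemma log_deriv_inverse:
  assumes "log_deriv K c x" "x * y = 1"
  shows "log_deriv K (\<lambda>n g. - c n g) y"
proof -
  let ?L = "Abs_fps (\<lambda>n. avg K (c n))"
  have "fps_deriv (x * y) = 0"
    by (simp add: assms(2))
  then have "x * (fps_deriv y + y * ?L) = 0"
    using assms(1) by (simp add: log_deriv_def algebra_simps)
  then have "y * x * (fps_deriv y + y * ?L) = 0"
    by (simp add: mult.assoc)
  then have "fps_deriv y = - (y * ?L)"
    using assms(2) by (simp add: mult.commute[of y x] eq_neg_iff_add_eq_0)
  moreover have "Abs_fps (\<lambda>n. avg K (\<lambda>g. - c n g)) = - ?L"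
    by (simp add: fps_eq_iff avg_uminus)
  moreover have "fps_nth (x * y) 0 = fps_nth y 0"
    using assms(1) by (simp add: log_deriv_def)
  ultimately show ?thesis
    using assms(2) by (simp add: log_deriv_def)
qed

context fin_add_group
begin

lemma single_zero_mem: "Poly_Mapping.single 0 a \<in> grp_alg K"
  by (simp add: grp_alg_def zero_K)

text \<open>The recursion stays inside \<complex>[K]. This places a series in the subring without
  looking at how it was constructed.\<close>

lemma log_deriv_mem:
  assumes "log_deriv K c x"
  shows "x \<in> grp_alg_fps K"
proof -
  have "fps_nth x n \<in> grp_alg K" for n
  proof (induction n rule: less_induct)
    case (less n)
    then show ?case
      using assms by (cases n) (auto simp: log_deriv_Suc[OF assms] log_deriv_def grp_alg.one_mem
          intro!: grp_alg.mult_mem grp_alg.sum_mem avg_mem single_zero_mem finite_K)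
  qed
  then show ?thesis
    by (simp add: grp_alg_fps_def)
qed

text \<open>The inverse formed in the ambient ring of power series is also the inverse in the
  subring once its coefficients lie in \<complex>[K], and its own logarithmic derivative shows that
  they do.\<close>

lemma log_deriv_ring_on_inverse:
  assumes x: "log_deriv K c x"
  shows "log_deriv K (\<lambda>n g. - c n g) (inv\<^bsub>ring_on (grp_alg_fps K)\<^esub> x)"
proof -
  \<comment> \<open>The argument 1 is the inverse of the constant term of x.\<close>
  let ?y = "fps_right_inverse x 1"
  have xy: "x * ?y = 1"
    using x by (intro fps_right_inverse) (simp add: log_deriv_def)
  then have y: "log_deriv K (\<lambda>n g. - c n g) ?y"
    by (rule log_deriv_inverse[OF x])
  have "inv\<^bsub>ring_on (grp_alg_fps K)\<^esub> x = ?y"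
    unfolding m_inv_def
  proof (rule the_equality)
    show "?y \<in> carrier (ring_on (grp_alg_fps K)) \<and> x \<otimes>\<^bsub>ring_on (grp_alg_fps K)\<^esub> ?y = \<one>\<^bsub>ring_on (grp_alg_fps K)\<^esub>
       \<and> ?y \<otimes>\<^bsub>ring_on (grp_alg_fps K)\<^esub> x = \<one>\<^bsub>ring_on (grp_alg_fps K)\<^esub>"
      using xy log_deriv_mem[OF y] by (simp add: ring_on_def mult.commute)
    fix z assume "z \<in> carrier (ring_on (grp_alg_fps K)) \<and> x \<otimes>\<^bsub>ring_on (grp_alg_fps K)\<^esub> z = \<one>\<^bsub>ring_on (grp_alg_fps K)\<^esub>
       \<and> z \<otimes>\<^bsub>ring_on (grp_alg_fps K)\<^esub> x = \<one>\<^bsub>ring_on (grp_alg_fps K)\<^esub>"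
    then have "z * x = 1"
      by (simp add: ring_on_def)
    then show "z = ?y"
      using mult.assoc[of z x ?y] xy by simp
  qed
  with y show ?thesis by simp
qed

end

section \<open>Formal exponential and logarithm\<close>

lemma lift_fps_nth: "fps_nth (lift_fps p) n = Poly_Mapping.single 0 (fps_nth p n)"
  by (simp add: lift_fps_def)

lemma fps_deriv_formal_exp:
  assumes P: "fps_nth P 0 = 0"
  shows "fps_deriv (formal_exp P) = formal_exp P * fps_deriv P"
proof (rule fps_ext)
  fix n
  let ?c = "\<lambda>j. Poly_Mapping.single (0::'a) (1 / fact j :: complex)"
  have c: "?c (Suc j) * of_nat (Suc j) = ?c j" for j
  proof -
    have "1 / fact (Suc j) * of_nat (Suc j) = (1 / fact j :: complex)"
      by (simp add: fact_Suc del: of_nat_Suc)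
    then show ?thesis
      unfolding of_nat_single mult_single by simp
  qed
  \<comment> \<open>As P has constant term 0, the coefficient of degree k in P^j vanishes for j > k;
    so one range of summation serves all k \<le> n.\<close>
  have ex: "fps_nth (formal_exp P) k = (\<Sum>j=0..n. ?c j * fps_nth (P ^ j) k)" if "k \<le> n" for k
  proof -
    have "fps_nth (formal_exp P) k = (\<Sum>j=0..k. ?c j * fps_nth (P ^ j) k)"
      by (simp add: formal_exp_def fps_compose_nth lift_fps_nth)
    also have "\<dots> = (\<Sum>j=0..n. ?c j * fps_nth (P ^ j) k)"
      using that startsby_zero_power_prefix[OF P] by (intro sum.mono_neutral_left) auto
    finally show ?thesis .
  qed
  have "fps_nth (fps_deriv (formal_exp P)) n
      = of_nat (Suc n) * (\<Sum>j=0..Suc n. ?c j * fps_nth (P ^ j) (Suc n))"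
    by (simp add: formal_exp_def fps_compose_nth lift_fps_nth)
  also have "\<dots> = (\<Sum>j=0..Suc n. ?c j * fps_nth (fps_deriv (P ^ j)) n)"
    unfolding sum_distrib_left by (intro sum.cong) (simp_all add: algebra_simps)
  \<comment> \<open>The term j = 0 is constant and drops out, so the index can be shifted; the
    factor j + 1 from the power rule then turns 1/(j+1)! into 1/j!.\<close>
  also have "\<dots> = (\<Sum>j=0..n. ?c (Suc j) * fps_nth (fps_deriv (P ^ Suc j)) n)"
    unfolding sum.atLeast0_atMost_Suc_shift o_def power_0 fps_deriv_1 fps_zero_nth by simp
  also have "\<dots> = (\<Sum>j=0..n. ?c j * fps_nth (P ^ j * fps_deriv P) n)"
  proof (rule sum.cong[OF refl])
    fix j
    have "fps_deriv (P ^ Suc j) = of_nat (Suc j) * (P ^ j * fps_deriv P)"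
      using fps_deriv_power'[of P "Suc j"] by (simp add: algebra_simps)
    then have "fps_nth (fps_deriv (P ^ Suc j)) n = of_nat (Suc j) * fps_nth (P ^ j * fps_deriv P) n"
      by (simp add: fps_of_nat[symmetric] del: of_nat_Suc)
    then show "?c (Suc j) * fps_nth (fps_deriv (P ^ Suc j)) n = ?c j * fps_nth (P ^ j * fps_deriv P) n"
      using c[of j] by (simp add: mult.assoc[symmetric] del: of_nat_Suc)
  qed
  also have "\<dots> = (\<Sum>k=0..n. (\<Sum>j=0..n. ?c j * fps_nth (P ^ j) k) * fps_nth (fps_deriv P) (n - k))"
    unfolding fps_mult_nth sum_distrib_left sum_distrib_right by (subst sum.swap) (simp add: mult.assoc)
  also have "\<dots> = fps_nth (formal_exp P * fps_deriv P) n"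
    unfolding fps_mult_nth by (intro sum.cong refl) (simp add: ex)
  finally show "fps_nth (fps_deriv (formal_exp P)) n = fps_nth (formal_exp P * fps_deriv P) n" .
qed

text \<open>Every ingredient of the series is supported at 0, and \<complex>[{0}] is a subring,
  being the group algebra of the trivial subgroup. Multiplying an average by such a coefficient
  therefore just scales its weight.\<close>

lemma formal_log_nth:
  "fps_nth (formal_log (1 - fps_X ^ 2) :: ('g::ab_group_add \<Rightarrow>\<^sub>0 complex) fps) n
     = Poly_Mapping.single 0 (Poly_Mapping.lookup (fps_nth (formal_log (1 - fps_X ^ 2) :: ('g \<Rightarrow>\<^sub>0 complex) fps) n) 0)"
proof -
  interpret fin_add_group "{0 :: 'g}"
    by unfold_locales auto
  let ?Q = "1 - fps_X ^ 2 - 1 :: ('g \<Rightarrow>\<^sub>0 complex) fps"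
  have Q: "fps_nth (?Q ^ i) k \<in> grp_alg {0}" for i k
  proof (induction i arbitrary: k)
    case 0
    show ?case by (simp add: grp_alg.zero_mem grp_alg.one_mem)
  next
    case (Suc i)
    have "fps_nth ?Q k \<in> grp_alg {0}" for k
      by (auto simp: fps_X_power_iff grp_alg.zero_mem grp_alg.one_mem grp_alg.uminus_mem)
    then show ?case
      unfolding power_Suc fps_mult_nth using Suc by (intro grp_alg.sum_mem grp_alg.mult_mem)
  qed
  have "fps_nth (formal_log (1 - fps_X ^ 2) :: ('g \<Rightarrow>\<^sub>0 complex) fps) n \<in> grp_alg {0}"
    unfolding formal_log_def fps_compose_nth lift_fps_nth
    using Q by (intro grp_alg.sum_mem grp_alg.mult_mem single_zero_mem)
  then show ?thesis
    by (intro poly_mapping_eqI) (auto simp: lookup_single when_def grp_alg_def in_keys_iff)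
qed

lemma formal_log_nth_0: "fps_nth (formal_log P) 0 = 0"
  by (simp add: formal_log_def fps_compose_nth lift_fps_nth fps_ln_def)

text \<open>The degree n part of the derivative of -chi log(1 - u^2), where chi has weight
  \<open>c\<close>. The coefficients of the logarithm are left unevaluated: what matters is that K
  does not occur.\<close>

definition gamma_coeff :: "('g::ab_group_add \<Rightarrow> complex) \<Rightarrow> nat \<Rightarrow> 'g \<Rightarrow> complex" where
  "gamma_coeff c n g = - (c g * (of_nat (Suc n) *
     Poly_Mapping.lookup (fps_nth (formal_log (1 - fps_X ^ 2) :: ('g \<Rightarrow>\<^sub>0 complex) fps) (Suc n)) 0))"

lemma log_deriv_formal_exp:
  assumes "chi = avg K c"
  shows "log_deriv K (gamma_coeff c) (formal_exp (- (fps_const chi * formal_log (1 - fps_X ^ 2))))"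
proof -
  let ?L = "formal_log (1 - fps_X ^ 2) :: ('a \<Rightarrow>\<^sub>0 complex) fps"
  let ?P = "- (fps_const chi * ?L)"
  have P0: "fps_nth ?P 0 = 0"
    by (simp add: formal_log_nth_0)
  have "fps_nth (formal_exp ?P) 0 = 1"
    by (simp add: formal_exp_def fps_compose_nth lift_fps_nth)
  moreover have "fps_deriv ?P = Abs_fps (\<lambda>n. avg K (gamma_coeff c n))"
  proof (rule fps_ext)
    fix n
    have "fps_nth (fps_deriv ?P) n = - (avg K c * (of_nat (Suc n) * fps_nth ?L (Suc n)))"
      by (simp add: assms algebra_simps)
    also have "\<dots> = - (avg K c * Poly_Mapping.single 0 (of_nat (Suc n) * Poly_Mapping.lookup (fps_nth ?L (Suc n)) 0))"
      by (subst formal_log_nth) (simp only: of_nat_single mult_single add_0)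
    also have "\<dots> = avg K (gamma_coeff c n)"
      unfolding avg_mult_single avg_uminus[symmetric] gamma_coeff_def ..
    finally show "fps_nth (fps_deriv ?P) n = fps_nth (Abs_fps (\<lambda>n. avg K (gamma_coeff c n))) n" by simp
  qed
  ultimately show ?thesis
    using fps_deriv_formal_exp[OF P0] by (simp add: log_deriv_def)
qed

lemma fps_nth_0_hom: "comm_ring_hom (\<lambda>f :: 'a::comm_ring_1 fps. fps_nth f 0)"
  by unfold_locales auto

text \<open>Taking the constant term is a ring homomorphism, hence commutes with the
  determinant.\<close>

lemma det_fps_nth_0:
  fixes A :: "'a::comm_ring_1 fps mat"
  assumes "A \<in> carrier_mat n n" "\<And>i j. i < n \<Longrightarrow> j < n \<Longrightarrow> fps_nth (A $$ (i, j)) 0 = (if i = j then 1 else 0)"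
  shows "fps_nth (det A) 0 = 1"
proof -
  have "map_mat (\<lambda>f. fps_nth f 0) A = 1\<^sub>m n"
    using assms by (intro eq_matI) auto
  then show ?thesis
    using comm_ring_hom.hom_det[OF fps_nth_0_hom, of A] by simp
qed

section \<open>The norm map\<close>

text \<open>Makes \<complex>[G] over \<complex>[H] the permutation module of H acting on G by
  translation, so that the norm falls under the results on permutation modules.\<close>

lemma perm_module_plus_smult: "smult (perm_module (+) X) = (*)"
proof (intro ext)
  fix a f :: "'a \<Rightarrow>\<^sub>0 complex"
  have s: "(\<Sum>g\<in>Poly_Mapping.keys b. Poly_Mapping.single g (Poly_Mapping.lookup b g)) = b" for b :: "'a \<Rightarrow>\<^sub>0 complex"
    by (intro poly_mapping_eqI) (auto simp: lookup_sum lookup_single when_def in_keys_iff)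
  have "a * f = (\<Sum>g\<in>Poly_Mapping.keys a. Poly_Mapping.single g (Poly_Mapping.lookup a g)) *
      (\<Sum>x\<in>Poly_Mapping.keys f. Poly_Mapping.single x (Poly_Mapping.lookup f x))"
    by (simp only: s)
  then show "a \<odot>\<^bsub>perm_module (+) X\<^esub> f = a * f"
    by (simp add: perm_module_def sum_product mult_single)
qed

lemma lookup_mult_single_one:
  "Poly_Mapping.lookup (a * Poly_Mapping.single v 1) (g + v) = Poly_Mapping.lookup (a :: 'g::ab_group_add \<Rightarrow>\<^sub>0 complex) g"
proof -
  have "Poly_Mapping.lookup (a * Poly_Mapping.single v 1) (g + v)
     = Poly_Mapping.lookup (smult (perm_module (+) UNIV) a (Poly_Mapping.single v 1)) (g + v)"
    by (simp add: perm_module_plus_smult)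
  also have "\<dots> = (\<Sum>h\<in>Poly_Mapping.keys a. if h = g then Poly_Mapping.lookup a g else 0)"
    by (auto simp: perm_module_def lookup_sum lookup_single when_def intro!: sum.cong)
  finally show ?thesis
    by (simp add: in_keys_iff)
qed

text \<open>Write M(z) for the matrix of multiplication by z in the redundant coordinates. The norm
  is the determinant of A = 1 - P + M(x). From x' = x y one gets A' = M(x) M(y), and this equals A
  M(y) because P M(y) = M(y). So the logarithmic derivative of the norm is the trace of
  M(y).\<close>

lemma log_deriv_norm_map:
  assumes G: "fin_add_group G" and H: "fin_add_group H" and sub: "H \<subseteq> G" and x: "log_deriv G c x"
  shows "log_deriv H c (norm_map G H x)"
proof -
  interpret G: fin_add_group G by fact
  interpret H: fin_add_group H by fact
  interpret A: fin_action H G "(+)"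
    using sub by unfold_locales (auto simp: G.finite_K G.add_K add.assoc)
  obtain e where e: "bij_betw e {..<card G} G"
    using A.enumeration by blast
  define gen :: "nat \<Rightarrow> ('a \<Rightarrow>\<^sub>0 complex) fps" where "gen i = fps_const (Poly_Mapping.single (e i) 1)" for i
  define crd :: "nat \<Rightarrow> ('a \<Rightarrow>\<^sub>0 complex) fps \<Rightarrow> ('a \<Rightarrow>\<^sub>0 complex) fps" where
    "crd i Q = Abs_fps (\<lambda>k. A.avg_coord (e i) (Poly_Mapping.lookup (fps_nth Q k)))" for i Q
  let ?M = "grp_alg_fps_module G"
  let ?n = "card G"
  interpret D: dual_basis "grp_alg_fps H" ?M ?n gen crd
    unfolding gen_def[abs_def] crd_def[abs_def] grp_alg_fps_def[of H]
    by (rule dual_basis_fps[OF A.dual_basis_perm_module[OF e]])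
      (auto simp: perm_module_plus_smult, auto simp: perm_module_def grp_alg_fps_module_def grp_alg_fps_def grp_alg_def)
  have M_simps: "carrier ?M = grp_alg_fps G" "smult ?M = (*)" "add ?M = (+)"
    by (simp_all add: grp_alg_fps_module_def)
  have mult: "y * z \<in> grp_alg_fps G" if "y \<in> grp_alg_fps G" "z \<in> grp_alg_fps G" for y z
    using that by (auto simp: grp_alg_fps_def fps_mult_nth intro!: G.grp_alg.sum_mem G.grp_alg.mult_mem)
  have endo: "D.endo (\<lambda>Q. y * Q)" if "y \<in> grp_alg_fps G" for y
    by (rule D.endoI) (use that in \<open>auto simp: M_simps mult algebra_simps\<close>)
  have gen: "gen i \<in> grp_alg_fps G" if "i < ?n" for i
    using D.gen_closed[OF that] by (simp add: M_simps)
  have xG: "x \<in> grp_alg_fps G"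
    by (rule G.log_deriv_mem[OF x])
  define y where "y = Abs_fps (\<lambda>n. avg G (c n))"
  have yG: "y \<in> grp_alg_fps G"
    by (simp add: y_def grp_alg_fps_def avg_mem G.finite_K)
  let ?A = "mat ?n ?n (\<lambda>(i, j). (if i = j then 1 else 0) - crd i (gen j) + crd i (x * gen j))"
  let ?W = "mat ?n ?n (\<lambda>(i, j). crd i (y * gen j))"
  have N: "norm_map G H x = det ?A"
    unfolding norm_map_def by (rule D.mod_det_eq[OF endo[OF xG]])
  have deriv_crd: "fps_deriv (crd i Q) = crd i (fps_deriv Q)" for i Q
  proof (rule fps_ext)
    fix n
    have "Poly_Mapping.lookup (of_nat (Suc n) * fps_nth Q (Suc n)) v = of_nat (Suc n) * Poly_Mapping.lookup (fps_nth Q (Suc n)) v" for v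
    proof -
      have "Poly_Mapping.lookup (of_nat m * a) v = of_nat m * Poly_Mapping.lookup a v" for m and a :: "'a \<Rightarrow>\<^sub>0 complex"
        by (induction m) (simp_all add: distrib_right plus_poly_mapping.rep_eq)
      then show ?thesis .
    qed
    then show "fps_nth (fps_deriv (crd i Q)) n = fps_nth (crd i (fps_deriv Q)) n"
      by (simp add: crd_def A.avg_coord_def of_nat_mult_avg del: of_nat_Suc)
  qed
  have "map_mat fps_deriv ?A = ?A * ?W"
  proof (rule eq_matI)
    fix i j assume "i < dim_row (?A * ?W)" "j < dim_col (?A * ?W)"
    then have i: "i < ?n" and j: "j < ?n" by auto
    have crd0: "crd i 0 = 0" for i
      by (simp add: crd_def fps_eq_iff A.avg_coord_def)
    have "map_mat fps_deriv ?A $$ (i, j) = crd i (fps_deriv (x * gen j))"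
      using i j by (simp add: deriv_crd) (simp add: gen_def crd0)
    also have "fps_deriv (x * gen j) = x * (y * gen j)"
      using x by (simp add: log_deriv_def gen_def y_def mult.assoc)
    also have "crd i (x * (y * gen j)) = (\<Sum>k<?n. crd k (y * gen j) * crd i (x * gen k))"
      using D.endo_coord[OF endo[OF xG] i] mult[OF yG gen[OF j]] by (simp add: M_simps)
    \<comment> \<open>Inserts (1 - P) W = 0, the expansion of \<open>y * gen j\<close> in the
      generators.\<close>
    also have "\<dots> = crd i (y * gen j) - (\<Sum>k<?n. crd k (y * gen j) * crd i (gen k)) + (\<Sum>k<?n. crd k (y * gen j) * crd i (x * gen k))"
      using D.coord_expand[OF i] mult[OF yG gen[OF j]] by (simp add: M_simps)
    also have "\<dots> = (\<Sum>k<?n. ((if i = k then 1 else 0) - crd i (gen k) + crd i (x * gen k)) * crd k (y * gen j))"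
    proof -
      have "(\<Sum>k<?n. (if i = k then 1 else 0) * crd k (y * gen j)) = crd i (y * gen j)"
        using i by (simp add: if_distrib[where f = "\<lambda>t. t * _"] cong: if_cong)
      then show ?thesis
        unfolding distrib_right left_diff_distrib sum.distrib sum_subtractf
        by (simp only: mult.commute[of "crd i z" for z])
    qed
    also have "\<dots> = (?A * ?W) $$ (i, j)"
      using i j by (simp add: scalar_prod_def atLeast0LessThan)
    finally show "map_mat fps_deriv ?A $$ (i, j) = (?A * ?W) $$ (i, j)" .
  qed auto
  then have "fps_deriv (norm_map G H x) = norm_map G H x * (\<Sum>i<?n. ?W $$ (i, i))"
    unfolding N by (intro fps_deriv_det_logarithmic[of _ ?n]) auto
  moreover have "(\<Sum>i<?n. ?W $$ (i, i)) = Abs_fps (\<lambda>n. avg H (c n))"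
  proof (rule fps_ext)
    fix n
    \<comment> \<open>The coefficient of \<open>y * gen i\<close> at g + e i is that of y at g, the
      same for each of the |G| generators. The factor |G| then cancels the normalisation over G, and
      the average over H is left.\<close>
    have "fps_nth (\<Sum>i<?n. ?W $$ (i, i)) n = (\<Sum>i<?n. avg H (\<lambda>g. Poly_Mapping.lookup (avg G (c n)) g))"
      by (simp add: fps_sum_nth crd_def A.avg_coord_def gen_def y_def lookup_mult_single_one)
    also have "\<dots> = avg H (\<lambda>g. of_nat ?n * Poly_Mapping.lookup (avg G (c n)) g)"
      by (simp add: of_nat_mult_avg)
    also have "\<dots> = avg H (c n)"
      using sub G.card_K by (intro avg_cong) (auto simp: lookup_avg G.finite_K)
    finally show "fps_nth (\<Sum>i<?n. ?W $$ (i, i)) n = fps_nth (Abs_fps (\<lambda>n. avg H (c n))) n" by simp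
  qed
  moreover have "fps_nth (norm_map G H x) 0 = 1"
    unfolding N using x by (intro det_fps_nth_0[of _ ?n]) (auto simp: crd_def gen_def log_deriv_def)
  ultimately show ?thesis
    by (simp add: log_deriv_def)
qed

section \<open>The polynomial \<open>eta\<close>\<close>

text \<open>
  The coefficients of the matrix power series \<open>W = T\<^sup>-\<^sup>1 * T'\<close> for \<open>T = 1 - A u + Q u\<^sup>2\<close>.
\<close>

fun quad_log_deriv :: "'x set \<Rightarrow> ('x \<Rightarrow> 'x \<Rightarrow> complex) \<Rightarrow> ('x \<Rightarrow> 'x \<Rightarrow> complex) \<Rightarrow> nat \<Rightarrow> 'x \<Rightarrow> 'x \<Rightarrow> complex" where
  "quad_log_deriv X A Q 0 x y = - A x y"
| "quad_log_deriv X A Q (Suc 0) x y = 2 * Q x y + (\<Sum>z\<in>X. A x z * quad_log_deriv X A Q 0 z y)"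
| "quad_log_deriv X A Q (Suc (Suc n)) x y = (\<Sum>z\<in>X. A x z * quad_log_deriv X A Q (Suc n) z y)
     - (\<Sum>z\<in>X. Q x z * quad_log_deriv X A Q n z y)"

context fin_action
begin

lemma avg_coord_diff: "avg_coord v (\<lambda>x. f x - f' x) = avg_coord v f - avg_coord v f'"
  by (simp add: avg_coord_def avg_diff)

text \<open>The operator has the matrix P - a u + q u^2, so the correction 1 - P in the determinant
  formula leaves 1 - a u + q u^2, with constant term 1. Since averaging respects products, the
  recursion for the complex matrices \<open>quad_log_deriv\<close> passes to their averages, which
  form the logarithmic derivative over \<complex>[K].\<close>

lemma log_deriv_quadratic_det:
  fixes A Q :: "'x \<Rightarrow> 'x \<Rightarrow> complex" and F F' :: "('x \<Rightarrow>\<^sub>0 complex) \<Rightarrow> 'x \<Rightarrow>\<^sub>0 complex"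
  defines "M \<equiv> poly_module (perm_module act X)"
  assumes A: "equivariant A" and Q: "equivariant Q"
    and F: "\<And>f. Poly_Mapping.keys f \<subseteq> X \<Longrightarrow> Poly_Mapping.keys (F f) \<subseteq> X"
      "\<And>f x. Poly_Mapping.keys f \<subseteq> X \<Longrightarrow> x \<in> X \<Longrightarrow>
        Poly_Mapping.lookup (F f) x = (\<Sum>z\<in>X. A x z * Poly_Mapping.lookup f z)"
    and F': "\<And>f. Poly_Mapping.keys f \<subseteq> X \<Longrightarrow> Poly_Mapping.keys (F' f) \<subseteq> X"
      "\<And>f x. Poly_Mapping.keys f \<subseteq> X \<Longrightarrow> x \<in> X \<Longrightarrow>
        Poly_Mapping.lookup (F' f) x = (\<Sum>z\<in>X. Q x z * Poly_Mapping.lookup f z)"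
  shows "log_deriv K (\<lambda>n g. \<Sum>v\<in>X. quad_log_deriv X A Q n (act g v) v)
    (fps_of_poly (mod_det (grp_alg_poly K) M
      (\<lambda>m. m \<ominus>\<^bsub>M\<^esub> [:0, 1:] \<odot>\<^bsub>M\<^esub> (F \<circ> m) \<oplus>\<^bsub>M\<^esub> [:0, 0, 1:] \<odot>\<^bsub>M\<^esub> (F' \<circ> m))))"
proof -
  obtain e where e: "bij_betw e {..<card X} X"
    using enumeration by blast
  let ?n = "card X"
  define gen :: "nat \<Rightarrow> 'x \<Rightarrow>\<^sub>0 complex" where "gen i = Poly_Mapping.single (e i) 1" for i
  define crd where "crd i f = avg_coord (e i) (Poly_Mapping.lookup f)" for i and f :: "'x \<Rightarrow>\<^sub>0 complex"
  interpret B: dual_basis "grp_alg K" "perm_module act X" ?n gen crd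
    unfolding gen_def[abs_def] crd_def[abs_def] by (rule dual_basis_perm_module[OF e])
  interpret P: dual_basis "grp_alg_poly K" M ?n "\<lambda>i. const_seq (perm_module act X) (gen i)"
    "\<lambda>i m. coeff_poly m (crd i)"
    unfolding M_def grp_alg_poly_def by (rule B.dual_basis_poly_module)
  have BF: "B.endo F" and BF': "B.endo F'"
    unfolding gen_def[abs_def] crd_def[abs_def]
    using endo_perm_module(1)[OF e A F] endo_perm_module(1)[OF e Q F'] by auto
  note PF = B.endo_poly_module(1)[OF BF, folded M_def] and PF' = B.endo_poly_module(1)[OF BF', folded M_def]
  have u: "[:0, 1:] \<in> grp_alg_poly K" "[:0, 0, 1:] \<in> grp_alg_poly K"
    by (auto simp: grp_alg_poly_def coeff_pCons grp_alg.zero_mem grp_alg.one_mem split: nat.split)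
  let ?T = "\<lambda>m. m \<ominus>\<^bsub>M\<^esub> [:0, 1:] \<odot>\<^bsub>M\<^esub> (F \<circ> m) \<oplus>\<^bsub>M\<^esub> [:0, 0, 1:] \<odot>\<^bsub>M\<^esub> (F' \<circ> m)"
  have endo: "P.endo ?T"
    by (intro P.endo_add P.endo_minus P.endo_smult P.endo_id PF PF' u)
  define a where "a i j = avg_coord (e i) (\<lambda>x. A x (e j))" for i j
  define q where "q i j = avg_coord (e i) (\<lambda>x. Q x (e j))" for i j
  have crdF: "crd i (F (gen j)) = a i j" "crd i (F' (gen j)) = q i j" if "i < ?n" "j < ?n" for i j
    using endo_perm_module(2)[OF e A F that] endo_perm_module(2)[OF e Q F' that]
    by (simp_all add: crd_def gen_def a_def q_def)
  let ?g = "\<lambda>i. const_seq (perm_module act X) (gen i)"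
  have T: "coeff_poly (?T (?g j)) (crd i) = [:crd i (gen j):] - [:0, 1:] * [:a i j:] + [:0, 0, 1:] * [:q i j:]"
    if i: "i < ?n" and j: "j < ?n" for i j
  proof -
    have g: "?g j \<in> carrier M"
      by (rule P.gen_closed[OF j])
    have Fg: "F \<circ> ?g j \<in> carrier M" "F' \<circ> ?g j \<in> carrier M"
      using P.endo_closed[OF PF g] P.endo_closed[OF PF' g] .
    have Fc: "coeff_poly (F \<circ> ?g j) (crd i) = [:a i j:]" "coeff_poly (F' \<circ> ?g j) (crd i) = [:q i j:]"
      unfolding B.endo_poly_module(2)[OF BF] B.endo_poly_module(2)[OF BF']
      using i j by (simp_all add: B.coeff_poly_const_seq B.endo_closed[OF BF] B.endo_closed[OF BF'] B.gen_closed crdF)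
    show ?thesis
      using i j g Fg u by (simp add: P.coord_add P.coord_minus P.coord_smult P.smult_closed P.add_closed
          Fc B.coeff_poly_const_seq B.gen_closed)
  qed
  let ?A = "mat ?n ?n (\<lambda>(i, j). (if i = j then 1 else 0) - fps_X * fps_const (a i j) + fps_X ^ 2 * fps_const (q i j))"
  have "fps_of_poly (mod_det (grp_alg_poly K) M ?T)
      = det (map_mat fps_of_poly (mat ?n ?n (\<lambda>(i, j). (if i = j then 1 else 0) - coeff_poly (?g j) (crd i) + coeff_poly (?T (?g j)) (crd i))))"
    unfolding P.mod_det_eq[OF endo]
    by (rule comm_ring_hom.hom_det[symmetric], unfold_locales) (simp_all add: fps_of_poly_add fps_of_poly_mult)
  also have "map_mat fps_of_poly (mat ?n ?n (\<lambda>(i, j). (if i = j then 1 else 0) - coeff_poly (?g j) (crd i) + coeff_poly (?T (?g j)) (crd i))) = ?A"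
  proof (rule eq_matI)
    fix i j assume "i < dim_row ?A" "j < dim_col ?A"
    then have i: "i < ?n" and j: "j < ?n" by auto
    have X2: "fps_of_poly [:0, 0, 1:] = (fps_X ^ 2 :: ('g \<Rightarrow>\<^sub>0 complex) fps)"
      by (simp add: fps_of_poly_pCons power2_eq_square)
    show "map_mat fps_of_poly (mat ?n ?n (\<lambda>(i, j). (if i = j then 1 else 0) - coeff_poly (?g j) (crd i) + coeff_poly (?T (?g j)) (crd i))) $$ (i, j) = ?A $$ (i, j)"
      using i j T[OF i j] B.coeff_poly_const_seq[OF i B.gen_closed[OF j]]
      by (simp only: index_map_mat index_mat dim_row_mat dim_col_mat split_conv fps_of_poly_add
          fps_of_poly_diff fps_of_poly_mult fps_of_poly_const fps_of_poly_fps_X X2)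
         (simp add: fps_of_poly_const)
  qed auto
  finally have eta: "fps_of_poly (mod_det (grp_alg_poly K) M ?T) = det ?A" .
  define w where "w k i j = avg_coord (e i) (\<lambda>x. quad_log_deriv X A Q k x (e j))" for k i j
  let ?W = "mat ?n ?n (\<lambda>(i, j). Abs_fps (\<lambda>k. w k i j))"
  \<comment> \<open>\<open>avg_coord_mult\<close> asks for equivariance of the left factor, here A,
    and leaves the right factor arbitrary.\<close>
  have aw: "(\<Sum>l<?n. a i l * w k l j) = avg_coord (e i) (\<lambda>x. \<Sum>z\<in>X. A x z * quad_log_deriv X A Q k z (e j))"
    if "i < ?n" for i j k
    unfolding a_def w_def
    using sum_enum[OF e, of "\<lambda>z. avg_coord (e i) (\<lambda>x. A x z) * avg_coord z (\<lambda>x. quad_log_deriv X A Q k x (e j))"]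
      avg_coord_mult[OF A enum_mem[OF e that]] by simp
  have qw: "(\<Sum>l<?n. q i l * w k l j) = avg_coord (e i) (\<lambda>x. \<Sum>z\<in>X. Q x z * quad_log_deriv X A Q k z (e j))"
    if "i < ?n" for i j k
    unfolding q_def w_def
    using sum_enum[OF e, of "\<lambda>z. avg_coord (e i) (\<lambda>x. Q x z) * avg_coord z (\<lambda>x. quad_log_deriv X A Q k x (e j))"]
      avg_coord_mult[OF Q enum_mem[OF e that]] by simp
  have w0: "w 0 i j = - a i j" for i j
    by (simp add: w_def a_def avg_coord_def avg_uminus)
  have w1: "w (Suc 0) i j = 2 * q i j + (\<Sum>l<?n. a i l * w 0 l j)" if "i < ?n" for i j
    unfolding aw[OF that] mult_2 q_def by (simp add: w_def avg_coord_add[symmetric])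
  have w2: "w (Suc (Suc k)) i j = (\<Sum>l<?n. a i l * w (Suc k) l j) - (\<Sum>l<?n. q i l * w k l j)" if "i < ?n" for i j k
    unfolding aw[OF that] qw[OF that] by (simp add: w_def avg_coord_diff)
  have "map_mat fps_deriv ?A = ?A * ?W"
  proof (rule eq_matI)
    fix i j assume "i < dim_row (?A * ?W)" "j < dim_col (?A * ?W)"
    then have i: "i < ?n" and j: "j < ?n" by auto
    let ?w = "\<lambda>l. Abs_fps (\<lambda>k. w k l j)"
    have split: "(\<Sum>l<?n. ((if i = l then 1 else 0) - fps_X * fps_const (a i l) + fps_X ^ 2 * fps_const (q i l)) * ?w l)
      = ?w i - fps_X * (\<Sum>l<?n. fps_const (a i l) * ?w l) + fps_X ^ 2 * (\<Sum>l<?n. fps_const (q i l) * ?w l)"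
    proof -
      have "(\<Sum>l<?n. (if i = l then 1 else 0) * ?w l) = ?w i"
        using i by (simp add: if_distrib[where f = "\<lambda>t. t * _"] cong: if_cong)
      then show ?thesis
        unfolding distrib_right left_diff_distrib sum.distrib sum_subtractf sum_distrib_left mult.assoc by simp
    qed
    have "fps_deriv ((if i = j then 1 else 0) - fps_X * fps_const (a i j) + fps_X ^ 2 * fps_const (q i j))
        = ?w i - fps_X * (\<Sum>l<?n. fps_const (a i l) * ?w l) + fps_X ^ 2 * (\<Sum>l<?n. fps_const (q i l) * ?w l)"
    proof (rule fps_ext)
      fix k
      have d: "fps_deriv ((if i = j then 1 else 0) - fps_X * fps_const (a i j) + fps_X ^ 2 * fps_const (q i j))
          = - fps_const (a i j) + fps_X * (fps_const (q i j) + fps_const (q i j))"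
        by (auto simp: power2_eq_square algebra_simps simp del: fps_const_add)
      \<comment> \<open>The left side is -a + 2 q u. Degrees 0 and 1 of the product match the first
        two clauses of the recursion, and the vanishing in higher degrees is the third.\<close>
      consider "k = 0" | "k = Suc 0" | k' where "k = Suc (Suc k')"
        by (cases k rule: nat.exhaust; cases "k - 1" rule: nat.exhaust) auto
      then show "fps_nth (fps_deriv ((if i = j then 1 else 0) - fps_X * fps_const (a i j) + fps_X ^ 2 * fps_const (q i j))) k
        = fps_nth (?w i - fps_X * (\<Sum>l<?n. fps_const (a i l) * ?w l) + fps_X ^ 2 * (\<Sum>l<?n. fps_const (q i l) * ?w l)) k"
      proof cases
        case 1
        then show ?thesis unfolding d by (simp add: power2_eq_square mult.assoc w0)
      next
        case 2
        then show ?thesis unfolding d by (simp add: power2_eq_square mult.assoc fps_sum_nth w1[OF i])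
      next
        case 3
        then show ?thesis unfolding d by (simp add: power2_eq_square mult.assoc fps_sum_nth w2[OF i])
      qed
    qed
    then show "map_mat fps_deriv ?A $$ (i, j) = (?A * ?W) $$ (i, j)"
      using i j split by (simp add: scalar_prod_def atLeast0LessThan)
  qed auto
  then have "fps_deriv (det ?A) = det ?A * (\<Sum>i<?n. ?W $$ (i, i))"
    by (intro fps_deriv_det_logarithmic[of _ ?n]) auto
  moreover have "(\<Sum>i<?n. ?W $$ (i, i)) = Abs_fps (\<lambda>n. avg K (\<lambda>g. \<Sum>v\<in>X. quad_log_deriv X A Q n (act g v) v))"
  proof (rule fps_ext)
    fix n
    have "fps_nth (\<Sum>i<?n. ?W $$ (i, i)) n = (\<Sum>i<?n. avg_coord (e i) (\<lambda>x. quad_log_deriv X A Q n x (e i)))"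
      by (simp add: fps_sum_nth w_def)
    also have "\<dots> = (\<Sum>v\<in>X. avg_coord v (\<lambda>x. quad_log_deriv X A Q n x v))"
      by (rule sum_enum[OF e])
    finally show "fps_nth (\<Sum>i<?n. ?W $$ (i, i)) n
        = fps_nth (Abs_fps (\<lambda>n. avg K (\<lambda>g. \<Sum>v\<in>X. quad_log_deriv X A Q n (act g v) v))) n"
      by (simp add: avg_coord_def avg_sum)
  qed
  moreover have "fps_nth (det ?A) 0 = 1"
    by (intro det_fps_nth_0[of _ ?n]) auto
  ultimately show ?thesis
    by (simp add: eta log_deriv_def)
qed

end

section \<open>Graphs\<close>

lemma fin_add_group_add_grp:
  assumes "group (add_grp K)" "finite K"
  shows "fin_add_group K"
proof -
  interpret group "add_grp K" by fact
  have zero: "0 \<in> K" and add: "\<And>g h. g \<in> K \<Longrightarrow> h \<in> K \<Longrightarrow> g + h \<in> K"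
    using one_closed m_closed by (auto simp: add_grp_def)
  have "- g \<in> K" if g: "g \<in> K" for g
  proof -
    obtain h where "h \<in> K" "h + g = 0"
      using l_inv_ex[of g] g by (auto simp: add_grp_def)
    then show ?thesis
      by (simp add: add_eq_0_iff2)
  qed
  then show ?thesis
    using zero add assms(2) by unfold_locales
qed

lemma fin_action_group_action:
  assumes "group_action (add_grp K) X act" "finite K" "finite X"
  shows "fin_action K X act"
proof -
  interpret group_action "add_grp K" X act by fact
  interpret fin_add_group K
    using group_hom.axioms(1)[OF group_hom] assms(2) by (rule fin_add_group_add_grp)
  show ?thesis
  proof
    show "act g x \<in> X" if "g \<in> K" "x \<in> X" for g x
      using element_image[of g x] that by (simp add: add_grp_def)
    show "act 0 x = x" if "x \<in> X" for x
      using fun_cong[OF id_eq_one, of x] that by (simp add: add_grp_def)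
    show "act (g + h) x = act g (act h x)" if "g \<in> K" "h \<in> K" "x \<in> X" for g h x
      using composition_rule[of x g h] that by (simp add: add_grp_def)
  qed fact
qed

locale graph_action = bidirected_digraph Y rv + fin_digraph Y
  for Y :: "('v, 'e) pre_digraph" and rv :: "'e \<Rightarrow> 'e" +
  fixes K :: "'g::ab_group_add set" and av :: "'g \<Rightarrow> 'v \<Rightarrow> 'v" and ae :: "'g \<Rightarrow> 'e \<Rightarrow> 'e"
  assumes action: "acts_without_inversion K Y rv av ae" and finite_K: "finite K"
begin

sublocale V: fin_action K "verts Y" av
  using action finite_K by (intro fin_action_group_action) (auto simp: acts_without_inversion_def)

sublocale E: fin_action_involution K "arcs Y" ae rv
proof -
  interpret fin_action K "arcs Y" ae
    using action finite_K by (intro fin_action_group_action) (auto simp: acts_without_inversion_def)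
  show "fin_action_involution K (arcs Y) ae rv"
    using action by unfold_locales (auto simp: acts_without_inversion_def)
qed

lemma tail_act: "g \<in> K \<Longrightarrow> e \<in> arcs Y \<Longrightarrow> tail Y (ae g e) = av g (tail Y e)"
  and head_act: "g \<in> K \<Longrightarrow> e \<in> arcs Y \<Longrightarrow> head Y (ae g e) = av g (head Y e)"
  using action by (auto simp: acts_without_inversion_def)

end

text \<open>The character of g on C_0 minus its character on C_1. In C_1 an arc sent to its reverse
  counts -1, and the factor 1/2 is due to each pair of opposite arcs being listed twice.\<close>

definition euler_coeff :: "('v, 'e) pre_digraph \<Rightarrow> ('e \<Rightarrow> 'e) \<Rightarrow> ('g \<Rightarrow> 'v \<Rightarrow> 'v) \<Rightarrow> ('g \<Rightarrow> 'e \<Rightarrow> 'e) \<Rightarrow> 'g \<Rightarrow> complex" where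
  "euler_coeff Y rv av ae g = (\<Sum>z\<in>verts Y. of_bool (av g z = z)) -
     (\<Sum>z\<in>arcs Y. (of_bool (ae g z = z) - of_bool (rv (ae g z) = z)) / 2)"

text \<open>Rows are heads and columns are tails, as the operator sends a vertex to the heads of the
  arcs leaving it.\<close>

definition adjacency_coeff :: "('v, 'e) pre_digraph \<Rightarrow> 'v \<Rightarrow> 'v \<Rightarrow> complex" where
  "adjacency_coeff Y x z = (\<Sum>e\<in>arcs Y. of_bool (tail Y e = z \<and> head Y e = x))"

text \<open>The matrix of D - I, not of D: it is the coefficient of u^2.\<close>

definition valency_coeff :: "('v, 'e) pre_digraph \<Rightarrow> 'v \<Rightarrow> 'v \<Rightarrow> complex" where
  "valency_coeff Y x z = of_bool (x = z) * ((\<Sum>e\<in>arcs Y. of_bool (tail Y e = z)) - 1)"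

definition eta_coeff :: "('v, 'e) pre_digraph \<Rightarrow> ('g \<Rightarrow> 'v \<Rightarrow> 'v) \<Rightarrow> nat \<Rightarrow> 'g \<Rightarrow> complex" where
  "eta_coeff Y av n g = (\<Sum>v\<in>verts Y. quad_log_deriv (verts Y) (adjacency_coeff Y) (valency_coeff Y) n (av g v) v)"

context graph_action
begin

lemma equiv_euler_char_eq: "equiv_euler_char Y rv av ae K = avg K (euler_coeff Y rv av ae)"
proof -
  have "C1 Y rv ae = quot_module (perm_module ae (arcs Y)) E.rels"
    by (simp add: C1_def edge_relations_def E.rels_def)
  then show ?thesis
    by (simp add: equiv_euler_char_def C0_def V.mod_rank_perm_module E.mod_rank_QM avg_diff[symmetric]
        euler_coeff_def[abs_def] E.proj_def)
qed

lemma log_deriv_gamma: "log_deriv K (gamma_coeff (euler_coeff Y rv av ae)) (gamma_fps Y rv av ae K)"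
  unfolding gamma_fps_def by (rule log_deriv_formal_exp[OF equiv_euler_char_eq])

text \<open>Translation by g permutes the arcs and carries those from z to x onto those from g z to
  g x.\<close>

lemma equivariant_adjacency_coeff: "V.equivariant (adjacency_coeff Y)"
  unfolding V.equivariant_def
proof (intro ballI)
  fix g x z assume g: "g \<in> K" and x: "x \<in> verts Y" and z: "z \<in> verts Y"
  have "adjacency_coeff Y (av g x) (av g z) = (\<Sum>e\<in>arcs Y. of_bool (tail Y (ae g e) = av g z \<and> head Y (ae g e) = av g x))"
    unfolding adjacency_coeff_def by (rule E.sum_act[OF g, symmetric])
  also have "\<dots> = adjacency_coeff Y x z"
    unfolding adjacency_coeff_def using g x z by (intro sum.cong) (auto simp: tail_act head_act V.act_inj)
  finally show "adjacency_coeff Y (av g x) (av g z) = adjacency_coeff Y x z" .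
qed

lemma equivariant_valency_coeff: "V.equivariant (valency_coeff Y)"
  unfolding V.equivariant_def
proof (intro ballI)
  fix g x z assume g: "g \<in> K" and x: "x \<in> verts Y" and z: "z \<in> verts Y"
  have "(\<Sum>e\<in>arcs Y. of_bool (tail Y e = av g z) :: complex) = (\<Sum>e\<in>arcs Y. of_bool (tail Y (ae g e) = av g z))"
    by (rule E.sum_act[OF g, symmetric])
  also have "\<dots> = (\<Sum>e\<in>arcs Y. of_bool (tail Y e = z))"
    using g z by (intro sum.cong) (auto simp: tail_act V.act_inj)
  finally show "valency_coeff Y (av g x) (av g z) = valency_coeff Y x z"
    using g x z by (simp add: valency_coeff_def V.act_inj)
qed

lemma lookup_adjacency_op:
  assumes f: "Poly_Mapping.keys f \<subseteq> verts Y"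
  shows "Poly_Mapping.lookup (adjacency_op Y f) x = (\<Sum>z\<in>verts Y. adjacency_coeff Y x z * Poly_Mapping.lookup f z)"
proof -
  have "Poly_Mapping.lookup (adjacency_op Y f) x
      = (\<Sum>z\<in>Poly_Mapping.keys f. (\<Sum>e\<in>out_arcs Y z. of_bool (head Y e = x)) * Poly_Mapping.lookup f z)"
    unfolding adjacency_op_def lookup_sum lookup_single sum_distrib_right
    by (intro sum.cong) (auto simp: when_def)
  also have "\<dots> = (\<Sum>z\<in>Poly_Mapping.keys f. adjacency_coeff Y x z * Poly_Mapping.lookup f z)"
  proof (intro sum.cong refl arg_cong2[where f = "(*)"])
    fix z
    have "(\<Sum>e\<in>out_arcs Y z. of_bool (head Y e = x)) = (\<Sum>e\<in>arcs Y. of_bool (tail Y e = z) * of_bool (head Y e = x) :: complex)"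
      by (intro sum.mono_neutral_cong_left) auto
    then show "(\<Sum>e\<in>out_arcs Y z. of_bool (head Y e = x)) = adjacency_coeff Y x z"
      by (simp add: adjacency_coeff_def of_bool_conj)
  qed
  also have "\<dots> = (\<Sum>z\<in>verts Y. adjacency_coeff Y x z * Poly_Mapping.lookup f z)"
    using f by (intro sum.mono_neutral_left) (auto simp: in_keys_iff)
  finally show ?thesis .
qed

lemma lookup_valency_op:
  assumes f: "Poly_Mapping.keys f \<subseteq> verts Y" and x: "x \<in> verts Y"
  shows "Poly_Mapping.lookup (valency_op Y f - f) x = (\<Sum>z\<in>verts Y. valency_coeff Y x z * Poly_Mapping.lookup f z)"
proof -
  have deg: "(\<Sum>e\<in>arcs Y. of_bool (tail Y e = z)) = (of_nat (out_degree Y z) :: complex)" for z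
  proof -
    have "out_arcs Y z = {e \<in> arcs Y. tail Y e = z}" by auto
    then show ?thesis
      by (simp add: out_degree_def Int_def sum_of_bool_eq)
  qed
  have "Poly_Mapping.lookup (valency_op Y f) x
      = (\<Sum>z\<in>Poly_Mapping.keys f. if z = x then of_nat (out_degree Y z) * Poly_Mapping.lookup f z else 0)"
    unfolding valency_op_def lookup_sum lookup_single by (intro sum.cong) (auto simp: when_def)
  also have "\<dots> = of_nat (out_degree Y x) * Poly_Mapping.lookup f x"
    by (simp add: in_keys_iff)
  moreover have "(\<Sum>z\<in>verts Y. valency_coeff Y x z * Poly_Mapping.lookup f z)
      = (\<Sum>z\<in>verts Y. if z = x then (of_nat (out_degree Y x) - 1) * Poly_Mapping.lookup f x else 0)"
    by (intro sum.cong) (auto simp: valency_coeff_def deg)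
  ultimately show ?thesis
    using x by (simp add: minus_poly_mapping.rep_eq left_diff_distrib)
qed

lemma keys_adjacency_op:
  assumes f: "Poly_Mapping.keys f \<subseteq> verts Y"
  shows "Poly_Mapping.keys (adjacency_op Y f) \<subseteq> verts Y"
  unfolding adjacency_op_def by (auto dest!: subsetD[OF keys_sum] split: if_splits)

lemma keys_valency_op:
  assumes f: "Poly_Mapping.keys f \<subseteq> verts Y"
  shows "Poly_Mapping.keys (valency_op Y f - f) \<subseteq> verts Y"
proof -
  have "Poly_Mapping.keys (valency_op Y f) \<subseteq> verts Y"
    unfolding valency_op_def using f by (auto dest!: subsetD[OF keys_sum] split: if_splits)
  then show ?thesis
    using f keys_diff[of "valency_op Y f" f] by blast
qed

lemma log_deriv_eta: "log_deriv K (eta_coeff Y av) (eta_fps Y av K)"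
  unfolding eta_fps_def eta_poly_def Let_def C0_def eta_coeff_def[abs_def]
  by (rule V.log_deriv_quadratic_det[OF equivariant_adjacency_coeff equivariant_valency_coeff keys_adjacency_op
      lookup_adjacency_op keys_valency_op lookup_valency_op])

text \<open>Theta receives a logarithmic derivative of its own, again with a weight free of K, so
  its norm is handled like the other two instead of through multiplicativity of the norm.\<close>

lemma log_deriv_theta:
  "log_deriv K (\<lambda>n g. - (gamma_coeff (euler_coeff Y rv av ae) n g + eta_coeff Y av n g)) (theta_fps Y rv av ae K)"
  unfolding theta_fps_def by (intro V.log_deriv_ring_on_inverse log_deriv_mult log_deriv_gamma log_deriv_eta)

end

theorem theorem4p12:
  fixes G H :: "'g::ab_group_add set"
    and Y :: "('v, 'e) pre_digraph" and rv :: "'e \<Rightarrow> 'e"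
    and av :: "'g \<Rightarrow> 'v \<Rightarrow> 'v" and ae :: "'g \<Rightarrow> 'e \<Rightarrow> 'e"
  assumes "comm_group (add_grp G)" and "finite G"
    and "subgroup H (add_grp G)"
    and "bidirected_digraph Y rv" and "fin_digraph Y"
    and "acts_without_inversion G Y rv av ae"
  shows "norm_map G H (gamma_fps Y rv av ae G) = gamma_fps Y rv av ae H \<and>
         norm_map G H (eta_fps Y av G) = eta_fps Y av H \<and>
         norm_map G H (theta_fps Y rv av ae G) = theta_fps Y rv av ae H"
proof -
  have sub: "H \<subseteq> G"
    using subgroup.subset[OF assms(3)] by (simp add: add_grp_def)
  interpret bidirected_digraph Y rv by fact
  interpret fin_digraph Y by fact
  interpret G: graph_action Y rv G av ae
    using assms(2,6) by unfold_locales
  interpret H: graph_action Y rv H av ae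
    using acts_without_inversion_subgroup[OF assms(6,3)] finite_subset[OF sub assms(2)] by unfold_locales
  note norm = log_deriv_norm_map[OF G.V.fin_add_group_axioms H.V.fin_add_group_axioms sub]
  show ?thesis
    using log_deriv_unique[OF norm[OF G.log_deriv_gamma] H.log_deriv_gamma]
      log_deriv_unique[OF norm[OF G.log_deriv_eta] H.log_deriv_eta]
      log_deriv_unique[OF norm[OF G.log_deriv_theta] H.log_deriv_theta] by blast
qed

end
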